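(* Let $SP(n)$ denote the number of SP numbers smaller than $n$. Then $SP(n)$ is asymptotic to $(\zeta(2)-1)\frac{n}{\log n}$ as $n \to \infty$, i.e. $$\lim_{n\to\infty} \frac{SP(n)}{(\zeta(2)-1)\, n/\log n} = 1,$$ where $\zeta$ is the Riemann zeta function, so $\zeta(2)-1 = \frac{\pi^2}{6}-1$.
   Context: A Square-Prime (SP) number is a positive integer of the form $p a^2$ where $p$ is a prime and $a \ge 2$ is a natural number (i.e. $a \neq 1$). Examples: $8 = 2\cdot 4$, $12 = 3 \cdot 4$, $75 = 3\cdot 25$. *)

theory Defs
  imports "HOL-Analysis.Analysis" "HOL-Computational_Algebra.Primes"
begin

definition SP_number :: "nat \<Rightarrow> bool" where
  "SP_number m \<longleftrightarrow> (\<exists>p a. prime p \<and> a \<ge> 2 \<and> m = p * a^2)"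

definition SP_count :: "nat \<Rightarrow> nat" where
  "SP_count n = card {m. m < n \<and> SP_number m}"

definition zeta_real :: "real \<Rightarrow> real" where
  "zeta_real s = (\<Sum>k. 1 / (real (Suc k)) powr s)"

end

theory Submission
  imports Defs "HOL-Complex_Analysis.Complex_Analysis" "HOL-Number_Theory.Prime_Powers"
    "HOL-Real_Asymp.Real_Asymp"
begin

text \<open>The representation \<open>m = p a\<^sup>2\<close> is unique because \<open>p\<close> is the only prime of odd multiplicity in \<open>m\<close>. Hence
  \<open>SP(n)\<close> is the sum of \<open>\<pi>((n - 1) / a\<^sup>2)\<close> over \<open>a \<ge> 2\<close>. By the prime number theorem the summand multiplied by
  \<open>ln n / n\<close> tends to \<open>1 / a\<^sup>2\<close>, and it is dominated by a multiple of \<open>a powr (-3/2)\<close>, so Tannery's theorem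
  gives the limit \<open>\<zeta>(2) - 1\<close>.

  The prime number theorem itself follows Newman and Zagier: \<open>-\<zeta>'/\<zeta> - \<zeta>\<close> is holomorphic on a neighbourhood of
  \<open>Re s \<ge> 1\<close>, so a Tauberian argument with a contour integral shows that the sum of
  \<open>(\<psi>(n) - n + c) / (n (n + 1))\<close> converges, which together with the monotonicity of \<open>\<psi>\<close> forces \<open>\<psi>(n) \<sim> n\<close>.
  The constant \<open>c\<close> normalises the limit function to vanish at the critical point.\<close>

subsection \<open>Newman's Tauberian theorem\<close>

text \<open>Two obstacles shape the analytic part. First, the argument is kept to series, without
  improper integrals. Subtracting the zeta function, rather than just its pole
  \<open>1 / (s - 1)\<close>, leaves the coefficients \<open>mangoldt n - 1\<close>, whose partial
  sums are exactly \<open>chebyshev_psi n - n\<close>. Abel summation turns the weights into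
  \<open>n powr (-s) - (n + 1) powr (-s)\<close>, which is \<open>s\<close> times the integral of
  \<open>t powr (-s - 1)\<close> over \<open>[n, n + 1]\<close>. Divided by \<open>s\<close>, these
  weights are entire, and at \<open>s = 1\<close> they equal \<open>1 / (n (n + 1))\<close>.

  Second, the pole of the kernel lies on the flat side of the half disc. The usual remedy moves that
  side to the left by an amount depending on the radius. Adding \<open>c\<close> to the coefficient
  at \<open>n = 1\<close> cancels the pole instead, so the contour may run through the critical
  point; a constant shift of the error is harmless later, being small against
  \<open>\<epsilon> * n\<close>.

  Chebyshev's bound has to precede all this, because a linear bound on the error supplies the growth
  hypothesis of the Tauberian theorem.\<close>

lemma circle_kernel:
  fixes w :: complex
  assumes "norm w = R" "R > 0"
  shows "(1 + w\<^sup>2 / (of_real R)\<^sup>2) / w = of_real (2 * Re w / R\<^sup>2)"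
proof -
  have w0: "w \<noteq> 0" using assms by auto
  have "(of_real R)\<^sup>2 = w * cnj w"
    using assms by (metis complex_norm_square of_real_power)
  moreover have "w + cnj w = of_real (2 * Re w)"
    by (simp add: complex_add_cnj)
  ultimately have "w\<^sup>2 + (of_real R)\<^sup>2 = of_real (2 * Re w) * w"
    by (metis distrib_left mult.commute power2_eq_square)
  moreover have "(1 + w\<^sup>2 / (of_real R)\<^sup>2) / w = (w\<^sup>2 + (of_real R)\<^sup>2) / ((of_real R)\<^sup>2 * w)"
    using assms w0 by (simp add: field_simps)
  ultimately show ?thesis using w0 by simp
qed

text \<open>The circle is cut at the imaginary axis because the right arc is also part of the half
  disc contour and its integral is later combined with that one. Removing \<open>f 0 / w\<close>
  from the integrand leaves an entire function, whose integral around the loop vanishes, and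
  \<open>1 / w\<close> integrates over an arc to \<open>\<i>\<close> times the angle.\<close>

lemma Cauchy_integral_two_arcs:
  assumes holf: "f holomorphic_on UNIV" and R: "R > 0"
  shows "contour_integral (part_circlepath 0 R (-pi/2) (pi/2)) (\<lambda>w. f w / w) +
         contour_integral (part_circlepath 0 R (pi/2) (3*pi/2)) (\<lambda>w. f w / w) = 2 * pi * \<i> * f 0"
    (is "contour_integral ?A _ + contour_integral ?B _ = _")
proof -
  define g where "g = (\<lambda>z. if z = 0 then deriv f 0 else (f z - f 0) / (z - 0))"
  have holg: "g holomorphic_on UNIV"
    unfolding g_def using holf by (intro pole_lemma_open) auto
  have join: "pathfinish ?A = pathstart ?B" by simp
  have exp_eq: "exp (\<i> * (3 * of_real pi / 2)) = exp (\<i> * (- of_real pi / 2))"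
  proof -
    have "exp (\<i> * (3 * of_real pi / 2)) = exp (\<i> * (- of_real pi / 2) + of_real (2 * pi) * \<i>)"
      by (simp add: field_simps)
    also have "\<dots> = exp (\<i> * (- of_real pi / 2))"
      by (subst exp_add) (simp add: exp_eq_1)
    finally show ?thesis .
  qed
  have loop: "pathfinish (?A +++ ?B) = pathstart (?A +++ ?B)"
    using exp_eq by simp
  have "(g has_contour_integral 0) (?A +++ ?B)"
    by (rule Cauchy_theorem_convex_simple[OF holg]) (use join loop in \<open>auto intro!: valid_path_join\<close>)
  moreover have contg: "g contour_integrable_on part_circlepath 0 R a b" for a b
    by (intro contour_integrable_continuous_part_circlepath holomorphic_on_imp_continuous_on
              holomorphic_on_subset[OF holg]) auto
  ultimately have sum0: "contour_integral ?A g + contour_integral ?B g = 0"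
    using contour_integral_unique contour_integral_join[OF contg contg] by force
  have split: "contour_integral (part_circlepath 0 R a b) (\<lambda>w. f w / w) =
                 contour_integral (part_circlepath 0 R a b) g + \<i> * (b - a) * f 0" if "a < b" for a b
  proof -
    have "((\<lambda>t. (f 0 / (0 + R * cis t)) * R * \<i> * cis t) has_integral (b - a) *\<^sub>R (\<i> * f 0)) {a..b}"
    proof -
      have "((\<lambda>t. \<i> * f 0) has_integral (b - a) *\<^sub>R (\<i> * f 0)) {a..b}"
        using has_integral_const_real[of "\<i> * f 0" a b] that by simp
      thus ?thesis using R by (simp add: field_simps)
    qed
    hence c: "((\<lambda>w. f 0 / w) has_contour_integral (b - a) *\<^sub>R (\<i> * f 0)) (part_circlepath 0 R a b)"
      using has_contour_integral_part_circlepath_iff[OF that, of "\<lambda>w. f 0 / w" _ 0 R] by simp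
    have "((\<lambda>w. g w + f 0 / w) has_contour_integral
             (contour_integral (part_circlepath 0 R a b) g + (b - a) *\<^sub>R (\<i> * f 0))) (part_circlepath 0 R a b)"
      by (intro has_contour_integral_add c has_contour_integral_integral contg)
    hence "((\<lambda>w. f w / w) has_contour_integral
             (contour_integral (part_circlepath 0 R a b) g + (b - a) *\<^sub>R (\<i> * f 0))) (part_circlepath 0 R a b)"
    proof (rule has_contour_integral_eq)
      fix w assume "w \<in> path_image (part_circlepath 0 R a b)"
      hence "w \<noteq> 0" using in_path_image_part_circlepath[of w 0 R a b] that R by auto
      thus "g w + f 0 / w = f w / w" by (simp add: g_def field_simps)
    qed
    thus ?thesis by (simp add: contour_integral_unique scaleR_conv_of_real mult_ac)
  qed
  show ?thesis
    using sum0 by (subst (1 2) split) (auto simp: field_simps)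
qed

text \<open>A quantitative Riemann-Lebesgue lemma: the exponential has modulus 1 on the segment, so
  one integration by parts gains the factor \<open>1 / L\<close>. The constant may depend on
  \<open>R\<close> and \<open>h\<close> but not on \<open>L\<close>.\<close>

lemma exp_integral_imaginary_segment_bound:
  fixes R :: real
  assumes U: "open U" "closed_segment (\<i> * R) (- \<i> * R) \<subseteq> U" and holh: "h holomorphic_on U"
  shows "\<exists>K. \<forall>L>0. norm (contour_integral (linepath (\<i> * R) (- \<i> * R)) (\<lambda>w. h w * exp (of_real L * w))) \<le> K / L"
proof -
  define a b where "a = \<i> * R" and "b = - \<i> * R"
  have seg: "closed_segment a b \<subseteq> U" using U by (simp add: a_def b_def)
  have Re0: "Re w = 0" if "w \<in> closed_segment a b" for w
    using that by (auto simp: closed_segment_def a_def b_def)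
  have holh': "deriv h holomorphic_on U" using U holh by (intro holomorphic_deriv)
  have "compact (deriv h ` closed_segment a b)"
    by (intro compact_continuous_image holomorphic_on_imp_continuous_on holomorphic_on_subset[OF holh' seg]) auto
  then obtain B where B: "\<And>w. w \<in> closed_segment a b \<Longrightarrow> norm (deriv h w) \<le> B" "B > 0"
    using bounded_pos[of "deriv h ` closed_segment a b"] compact_imp_bounded by auto
  define K where "K = norm (h a) + norm (h b) + B * norm (b - a)"
  have "norm (contour_integral (linepath a b) (\<lambda>w. h w * exp (of_real L * w))) \<le> K / L" if L: "L > 0" for L :: real
  proof -
    define F where "F = (\<lambda>w. h w * exp (of_real L * w) / of_real L)"
    have e1: "norm (exp (of_real L * w)) = 1" if "w \<in> closed_segment a b" for w
      using Re0[OF that] by simp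
    have dF: "(F has_field_derivative (deriv h w * exp (of_real L * w) / L + h w * exp (of_real L * w))) (at w within closed_segment a b)"
      if "w \<in> closed_segment a b" for w
    proof -
      have "(h has_field_derivative deriv h w) (at w within closed_segment a b)"
        using that seg holh U by (meson DERIV_subset holomorphic_derivI subsetD subset_UNIV)
      thus ?thesis unfolding F_def using L
        by (auto intro!: derivative_eq_intros simp: field_simps)
    qed
    have "((\<lambda>w. deriv h w * exp (of_real L * w) / L + h w * exp (of_real L * w)) has_contour_integral (F b - F a)) (linepath a b)"
      using contour_integral_primitive[OF dF, of "linepath a b"] by simp
    moreover have int': "(\<lambda>w. deriv h w * exp (of_real L * w) / L) contour_integrable_on (linepath a b)"
      by (intro contour_integrable_continuous_linepath continuous_intros 
          holomorphic_on_imp_continuous_on[OF holomorphic_on_subset[OF holh' seg]]) (use L in auto)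
    ultimately have "((\<lambda>w. (deriv h w * exp (of_real L * w) / L + h w * exp (of_real L * w)) - deriv h w * exp (of_real L * w) / L) 
        has_contour_integral (F b - F a - contour_integral (linepath a b) (\<lambda>w. deriv h w * exp (of_real L * w) / L))) (linepath a b)"
      by (intro has_contour_integral_diff has_contour_integral_integral)
    hence eq: "contour_integral (linepath a b) (\<lambda>w. h w * exp (of_real L * w)) =
       F b - F a - contour_integral (linepath a b) (\<lambda>w. deriv h w * exp (of_real L * w) / L)"
      by (simp add: contour_integral_unique)
    have "norm (contour_integral (linepath a b) (\<lambda>w. deriv h w * exp (of_real L * w) / L)) \<le> B / L * norm (b - a)"
    proof (rule contour_integral_bound_linepath[OF int'])
      fix x assume "x \<in> closed_segment a b"
      thus "norm (deriv h x * exp (of_real L * x) / L) \<le> B / L"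
        using B L e1[of x] by (simp add: norm_mult norm_divide divide_right_mono del: norm_exp_eq_Re)
    qed (use B L in auto)
    moreover have "norm (F a) = norm (h a) / L" "norm (F b) = norm (h b) / L"
      using e1[of a] e1[of b] L by (simp_all add: F_def norm_mult norm_divide del: norm_exp_eq_Re)
    ultimately have "norm (contour_integral (linepath a b) (\<lambda>w. h w * exp (of_real L * w))) \<le>
                       norm (h b) / L + norm (h a) / L + B / L * norm (b - a)"
      unfolding eq by (smt (verit) norm_triangle_ineq4)
    thus ?thesis by (simp add: K_def add_divide_distrib)
  qed
  thus ?thesis unfolding a_def b_def by blast
qed

text \<open>Since the limit function vanishes at \<open>0\<close>, it is integrated along the boundary of a half disc whose flat
  side is the imaginary segment itself, where the contribution decays like \<open>1 / ln N\<close>; the partial sums,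
  being entire, are integrated along the full circle. On the arcs the kernel \<open>(1 + w\<^sup>2 / R\<^sup>2) / w\<close> cancels the
  factor \<open>1 / Re w\<close> of the bounds.\<close>

lemma newman_tauberian:
  fixes g :: "nat \<Rightarrow> complex \<Rightarrow> complex"
  assumes C: "C \<ge> 0"
    and holg: "\<And>k. g k holomorphic_on UNIV"
    and bound: "\<And>k w. Re w \<noteq> 0 \<Longrightarrow>
      norm (g k w) \<le> C * ((real (Suc k) powr (-Re w) - real (Suc (Suc k)) powr (-Re w)) / Re w)"
    and U: "open U" "{w. Re w \<ge> 0} \<subseteq> U" and holQ: "Q holomorphic_on U"
    and sums: "\<And>w. Re w > 0 \<Longrightarrow> (\<lambda>k. g k w) sums (w * Q w)"
  shows "(\<lambda>k. g k 0) sums 0"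
proof -
  define S where "S = (\<lambda>N w. \<Sum>k<N. g k w)"
  have holS: "S N holomorphic_on A" for N A
    unfolding S_def by (intro holomorphic_intros holomorphic_on_subset[OF holg]) auto
  have tail: "norm (w * Q w - S N w) \<le> C * (real (Suc N) powr (-Re w) / Re w)" if w: "Re w > 0" for N w
  proof -
    have "(\<lambda>k. g (k + N) w) sums (w * Q w - S N w)"
      unfolding S_def using sums[OF w] by (rule sums_split_initial_segment)
    moreover have "(\<lambda>k. real (Suc (k + N)) powr (-Re w) - real (Suc (Suc k + N)) powr (-Re w)) sums
        (real (Suc (0 + N)) powr (-Re w) - 0)"
    proof (rule telescope_sums')
      show "(\<lambda>k. real (Suc (k + N)) powr - Re w) \<longlonglongrightarrow> 0"
        using w by real_asymp
    qed
    hence "(\<lambda>k. C * ((real (Suc (k + N)) powr (-Re w) - real (Suc (Suc k + N)) powr (-Re w)) / Re w)) sums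
        (C * ((real (Suc (0 + N)) powr (-Re w) - 0) / Re w))"
      by (intro sums_mult sums_divide)
    ultimately have "norm (w * Q w - S N w) \<le> C * ((real (Suc (0 + N)) powr (-Re w) - 0) / Re w)"
    proof (rule norm_sums_le)
      show "norm (g (k + N) w) \<le> C * ((real (Suc (k + N)) powr (-Re w) - real (Suc (Suc k + N)) powr (-Re w)) / Re w)" for k
        using bound[of w "k + N"] w by simp
    qed
    thus ?thesis by simp
  qed
  have head: "norm (S N w) \<le> C * (real (Suc N) powr (-Re w) / (- Re w))" if w: "Re w < 0" for N w
  proof -
    have "norm (S N w) \<le> (\<Sum>k<N. C * ((real (Suc k) powr (-Re w) - real (Suc (Suc k)) powr (-Re w)) / Re w))"
      unfolding S_def by (rule sum_norm_le) (use bound[of w] w in auto)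
    also have "\<dots> = C * ((\<Sum>k<N. real (Suc k) powr (-Re w) - real (Suc (Suc k)) powr (-Re w)) / Re w)"
      by (simp add: sum_distrib_left sum_divide_distrib)
    also have "(\<Sum>k<N. real (Suc k) powr (-Re w) - real (Suc (Suc k)) powr (-Re w)) = 1 - real (Suc N) powr (-Re w)"
      by (subst sum_lessThan_telescope') simp
    \<comment> \<open>The discarded term is \<open>1 / Re w\<close>, which is negative in the left
      half plane.\<close>
    also have "C * ((1 - real (Suc N) powr (-Re w)) / Re w) \<le> C * (real (Suc N) powr (-Re w) / (- Re w))"
      using w C by (intro mult_left_mono) (auto simp: field_simps)
    finally show ?thesis .
  qed
  \<comment> \<open>Each arc has length \<open>pi * R\<close> and carries an integrand of size at
    most \<open>2 * C / R\<^sup>2\<close>; both together, divided by \<open>2 * pi\<close>, give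
    \<open>2 * C / R\<close>. Since \<open>K\<close> depends on \<open>R\<close>, the radius must be
    fixed before \<open>N\<close> grows.\<close>
  have main: "\<exists>K. \<forall>N\<ge>1. norm (S N 0) \<le> 2 * C / R + K / ln (real (Suc N))" if R: "R > 0" for R :: real
  proof -
    define A where "A = part_circlepath 0 R (-pi/2) (pi/2)"
    define B where "B = part_circlepath 0 R (pi/2) (3*pi/2)"
    define I where "I = linepath (\<i> * R) (- \<i> * R)"
    define h where "h = (\<lambda>w. Q w * (1 + w\<^sup>2 / (of_real R)\<^sup>2))"
    have holh: "h holomorphic_on U"
      unfolding h_def using R by (intro holomorphic_intros holQ) auto
    have segU: "closed_segment (\<i> * R) (- \<i> * R) \<subseteq> {w. Re w \<ge> 0}"
      by (auto simp: closed_segment_def)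
    obtain K where K: "\<And>L. L > 0 \<Longrightarrow> norm (contour_integral I (\<lambda>w. h w * exp (of_real L * w))) \<le> K / L"
      using exp_integral_imaginary_segment_bound[OF U(1) _ holh, of R] segU U(2) unfolding I_def by blast
    have "norm (S N 0) \<le> 2 * C / R + (K / (2 * pi)) / ln (real (Suc N))" if N: "N \<ge> 1" for N
    proof -
      \<comment> \<open>With this choice \<open>exp (L * w)\<close> has modulus
        \<open>real (Suc N) powr Re w\<close>, the exact inverse of the power in \<open>tail\<close>
        and \<open>head\<close>.\<close>
      define L where "L = ln (real (Suc N))"
      have L: "L > 0" using N by (simp add: L_def)
      define e where "e = (\<lambda>w::complex. exp (of_real L * w))"
      define k where "k = (\<lambda>w::complex. 1 + w\<^sup>2 / (of_real R)\<^sup>2)"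
      have h_eq: "h w = Q w * k w" for w by (simp add: h_def k_def)
      have norm_e: "norm (e w) = real (Suc N) powr (Re w)" for w
        by (simp add: e_def L_def powr_def mult_ac)
      have hole: "e holomorphic_on X" "k holomorphic_on X" for X
        unfolding e_def k_def using R by (auto intro!: holomorphic_intros)
      have k_circle: "k w / w = of_real (2 * Re w / R\<^sup>2)" if "norm w = R" for w :: complex
        unfolding k_def using circle_kernel[OF that R] .
      have arcA: "norm w = R" "Re w \<ge> 0" if w: "w \<in> path_image A" for w
      proof -
        show "norm w = R" using in_path_image_part_circlepath[of w 0 R] w R unfolding A_def by force
        obtain x where x: "w = 0 + R * cis x" "x \<in> {-pi/2..pi/2}"
          using w unfolding A_def path_image_part_circlepath' closed_segment_eq_real_ivl by force
        thus "Re w \<ge> 0" using R cos_ge_zero[of x] by auto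
      qed
      have arcB: "norm w = R" "Re w \<le> 0" if w: "w \<in> path_image B" for w
      proof -
        show "norm w = R" using in_path_image_part_circlepath[of w 0 R] w R unfolding B_def by force
        obtain x where x: "w = 0 + R * cis x" "x \<in> {pi/2..3*pi/2}"
          using w unfolding B_def path_image_part_circlepath' closed_segment_eq_real_ivl by force
        have "cos (x - pi) \<ge> 0" using x by (intro cos_ge_zero) auto
        hence "cos x \<le> 0" by simp
        thus "Re w \<le> 0" using R x by (auto simp: mult_nonneg_nonpos)
      qed
      define f where "f = (\<lambda>w. S N w * e w * k w)"
      have holf: "f holomorphic_on UNIV" unfolding f_def by (intro holomorphic_intros holS hole)
      have two: "contour_integral A (\<lambda>w. f w / w) + contour_integral B (\<lambda>w. f w / w) = 2 * pi * \<i> * S N 0"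
        using Cauchy_integral_two_arcs[OF holf R] unfolding A_def B_def by (simp add: f_def e_def k_def)
      have intf: "(\<lambda>w. f w / w) contour_integrable_on A" "(\<lambda>w. f w / w) contour_integrable_on B"
        unfolding A_def B_def
        by (intro contour_integrable_continuous_part_circlepath continuous_intros 
             holomorphic_on_imp_continuous_on holomorphic_on_subset[OF holf]; 
            use arcA arcB R in \<open>force simp: A_def B_def\<close>)+
      have halfplane: "convex {w. Re w \<ge> 0}" using convex_halfspace_Re_ge .
      have holhe: "(\<lambda>w. h w * e w) holomorphic_on {w. Re w \<ge> 0}"
        by (intro holomorphic_intros holomorphic_on_subset[OF holh U(2)] hole)
      have exp_half: "exp (\<i> * of_real pi / 2) = \<i>" "exp (- (\<i> * of_real pi / 2)) = - \<i>"
        using cis_pi_half by (simp_all add: cis_conv_exp exp_minus)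
      have ends: "pathfinish A = pathstart I" "pathfinish I = pathstart A"
        unfolding A_def I_def by (auto simp: exp_half)
      have "((\<lambda>w. h w * e w) has_contour_integral 0) (A +++ I)"
      proof (rule Cauchy_theorem_convex_simple[OF holhe halfplane])
        show "valid_path (A +++ I)" using ends unfolding A_def I_def by (intro valid_path_join) auto
        show "path_image (A +++ I) \<subseteq> {w. Re w \<ge> 0}"
          using arcA segU by (intro order.trans[OF path_image_join_subset]) (auto simp: I_def)
      qed (use ends in auto)
      moreover have inthe: "(\<lambda>w. h w * e w) contour_integrable_on A" "(\<lambda>w. h w * e w) contour_integrable_on I"
        using holomorphic_on_imp_continuous_on[OF holhe] arcA segU unfolding A_def I_def
        by (auto intro!: contour_integrable_continuous_part_circlepath contour_integrable_continuous_linepath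
                 elim!: continuous_on_subset)
      ultimately have zero: "contour_integral A (\<lambda>w. h w * e w) + contour_integral I (\<lambda>w. h w * e w) = 0"
        using contour_integral_unique contour_integral_join[OF inthe] 
        by (metis A_def I_def valid_path_linepath valid_path_part_circlepath)
      \<comment> \<open>On the right arc the two integrands are estimated only through their
        difference, which contains the tail of the series.\<close>
      have bA: "norm (contour_integral A (\<lambda>w. h w * e w - f w / w)) \<le> (2 * C / R\<^sup>2) * R * \<bar>pi/2 - (-pi/2)\<bar>"
        unfolding A_def
      proof (rule contour_integral_bound_part_circlepath)
        show "(\<lambda>w. h w * e w - f w / w) contour_integrable_on part_circlepath 0 R (- pi / 2) (pi / 2)"
          using intf inthe unfolding A_def by (intro contour_integrable_diff)
        fix w assume "w \<in> path_image (part_circlepath 0 R (- pi / 2) (pi / 2))"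
        hence w: "norm w = R" "Re w \<ge> 0" using arcA unfolding A_def by blast+
        hence w0: "w \<noteq> 0" using R by auto
        have "h w * e w - f w / w = (w * Q w - S N w) * e w * (k w / w)"
          using w0 by (simp add: h_eq f_def field_simps)
        also have "\<dots> = (w * Q w - S N w) * e w * of_real (2 * Re w / R\<^sup>2)"
          using k_circle[OF w(1)] by simp
        finally have eq: "norm (h w * e w - f w / w) = norm (w * Q w - S N w) * real (Suc N) powr Re w * (2 * Re w / R\<^sup>2)"
          using w R by (simp add: norm_mult norm_e norm_divide norm_power)
        show "norm (h w * e w - f w / w) \<le> 2 * C / R\<^sup>2"
        \<comment> \<open>At the end points of the arc \<open>tail\<close> does not apply, but the
          kernel vanishes there.\<close>
        proof (cases "Re w = 0")
          case True show ?thesis unfolding eq using True C by simp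
        next
          case False
          hence pos: "Re w > 0" using w by simp
          have "norm (h w * e w - f w / w) \<le> (C * (real (Suc N) powr (-Re w) / Re w)) * real (Suc N) powr Re w * (2 * Re w / R\<^sup>2)"
            unfolding eq using tail[OF pos] pos by (intro mult_right_mono) auto
          also have "\<dots> = 2 * C / R\<^sup>2"
            using pos R by (simp add: powr_minus field_simps)
          finally show ?thesis .
        qed
      qed (use C R in auto)
      have bB: "norm (contour_integral B (\<lambda>w. f w / w)) \<le> (2 * C / R\<^sup>2) * R * \<bar>3*pi/2 - pi/2\<bar>"
        unfolding B_def
      proof (rule contour_integral_bound_part_circlepath)
        show "(\<lambda>w. f w / w) contour_integrable_on part_circlepath 0 R (pi / 2) (3 * pi / 2)"
          using intf unfolding B_def by simp
        fix w assume "w \<in> path_image (part_circlepath 0 R (pi / 2) (3 * pi / 2))"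
        hence w: "norm w = R" "Re w \<le> 0" using arcB unfolding B_def by blast+
        have "f w / w = S N w * e w * of_real (2 * Re w / R\<^sup>2)"
          unfolding k_circle[OF w(1), symmetric] by (simp add: f_def)
        hence eq: "norm (f w / w) = norm (S N w) * real (Suc N) powr Re w * (2 * (-Re w) / R\<^sup>2)"
          using w R by (simp add: norm_mult norm_e norm_divide norm_power)
        show "norm (f w / w) \<le> 2 * C / R\<^sup>2"
        proof (cases "Re w = 0")
          case True show ?thesis unfolding eq using True C by simp
        next
          case False
          hence neg: "Re w < 0" using w by simp
          have "norm (f w / w) \<le> (C * (real (Suc N) powr (-Re w) / (-Re w))) * real (Suc N) powr Re w * (2 * (-Re w) / R\<^sup>2)"
            unfolding eq using head[OF neg] neg by (intro mult_right_mono) (auto simp: divide_le_0_iff)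
          also have "\<dots> = 2 * C / R\<^sup>2"
            using neg R by (simp add: powr_minus field_simps)
          finally show ?thesis .
        qed
      qed (use C R in auto)
      have "contour_integral A (\<lambda>w. h w * e w - f w / w) = contour_integral A (\<lambda>w. h w * e w) - contour_integral A (\<lambda>w. f w / w)"
        using intf inthe by (intro contour_integral_diff)
      \<comment> \<open>The integral of \<open>h w * e w\<close> over the right arc is traded for
        minus the one over the segment, as the half disc contour has integral 0.\<close>
      hence "2 * pi * \<i> * S N 0 = contour_integral B (\<lambda>w. f w / w) - contour_integral I (\<lambda>w. h w * e w) 
                - contour_integral A (\<lambda>w. h w * e w - f w / w)"
        using zero unfolding two[symmetric] by (simp add: add_eq_0_iff)
      moreover have "norm (contour_integral I (\<lambda>w. h w * e w)) \<le> K / L"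
        using K[OF L] by (simp add: e_def)
      moreover have "norm (b - i - d) \<le> norm b + norm i + norm d" for b i d :: complex
        using norm_triangle_ineq4[of "b - i" d] norm_triangle_ineq4[of b i] by linarith
      moreover have "\<bar>pi/2 - (-pi/2)\<bar> = pi" "\<bar>3*pi/2 - pi/2\<bar> = pi" by simp_all
      ultimately have "norm (2 * pi * \<i> * S N 0) \<le> (2 * C / R\<^sup>2) * R * pi + K / L + (2 * C / R\<^sup>2) * R * pi"
        using bA bB by (smt (verit))
      also have "\<dots> = 2 * pi * (2 * C / R + (K / (2 * pi)) / L)"
        using R by (simp add: field_simps power2_eq_square)
      finally have "2 * pi * norm (S N 0) \<le> 2 * pi * (2 * C / R + (K / (2 * pi)) / L)"
        by (simp add: norm_mult)
      thus ?thesis unfolding L_def by (subst (asm) mult_le_cancel_left_pos) auto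
    qed
    thus ?thesis by blast
  qed
  have "(\<lambda>N. S N 0) \<longlonglongrightarrow> 0"
  proof (rule metric_LIMSEQ_I)
    fix \<epsilon> :: real assume \<epsilon>: "\<epsilon> > 0"
    \<comment> \<open>\<open>4 * C / \<epsilon>\<close> makes the arcs contribute
      \<open>\<epsilon> / 2\<close>; the summand 1 makes the inequality strict and \<open>R\<close>
      positive even if \<open>C = 0\<close>.\<close>
    define R where "R = 4 * C / \<epsilon> + 1"
    have R: "R > 0" using C \<epsilon> by (simp add: R_def add_nonneg_pos)
    have R2: "2 * C / R < \<epsilon> / 2"
      using C \<epsilon> R by (simp add: R_def field_simps)
    obtain K where K: "\<And>N. N \<ge> 1 \<Longrightarrow> norm (S N 0) \<le> 2 * C / R + K / ln (real (Suc N))"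
      using main[OF R] by blast
    have "(\<lambda>N. K / ln (real (Suc N))) \<longlonglongrightarrow> 0" by real_asymp
    then have "eventually (\<lambda>N. K / ln (real (Suc N)) < \<epsilon> / 2) sequentially"
      using \<epsilon> by (intro order_tendstoD) auto
    then obtain N0 where N0: "\<And>N. N \<ge> N0 \<Longrightarrow> K / ln (real (Suc N)) < \<epsilon> / 2"
      by (auto simp: eventually_at_top_linorder)
    show "\<exists>N0. \<forall>N\<ge>N0. dist (S N 0) 0 < \<epsilon>"
    proof (intro exI allI impI)
      fix N assume "N \<ge> max 1 N0"
      hence "norm (S N 0) < \<epsilon> / 2 + \<epsilon> / 2"
        using K[of N] N0[of N] R2 by linarith
      thus "dist (S N 0) 0 < \<epsilon>" by simp
    qed
  qed
  thus ?thesis unfolding S_def sums_def .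
qed

subsection \<open>Chebyshev bounds\<close>

definition chebyshev_psi :: "nat \<Rightarrow> real" where
  "chebyshev_psi n = (\<Sum>k=1..n. mangoldt k)"

definition prime_pi :: "real \<Rightarrow> nat" where
  "prime_pi x = card {p. prime p \<and> real p \<le> x}"

lemma chebyshev_psi_nonneg: "chebyshev_psi n \<ge> 0"
  unfolding chebyshev_psi_def by (intro sum_nonneg mangoldt_nonneg)

lemma chebyshev_psi_mono: "m \<le> n \<Longrightarrow> chebyshev_psi m \<le> chebyshev_psi n"
  unfolding chebyshev_psi_def by (intro sum_mono2 mangoldt_nonneg) auto

text \<open>In passing from \<open>n\<close> to \<open>n + 1\<close> the quotient
  \<open>n div d\<close> grows by 1 exactly for the divisors \<open>d\<close> of
  \<open>n + 1\<close>, and \<open>mangoldt\<close> sums to \<open>ln (n + 1)\<close> over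
  these.\<close>

lemma ln_fact_eq_sum_mangoldt: "ln (fact n) = (\<Sum>d=1..n. mangoldt d * real (n div d))"
proof (induction n)
  case (Suc n)
  have div_eq: "Suc n div d = n div d + (if d dvd Suc n then 1 else 0)" if "d \<ge> 1" for d
    by (simp add: div_Suc dvd_eq_mod_eq_0)
  have "(\<Sum>d=1..Suc n. mangoldt d * real (Suc n div d)) =
        (\<Sum>d=1..Suc n. mangoldt d * real (n div d) + (if d dvd Suc n then mangoldt d else 0))"
    by (intro sum.cong refl) (simp add: div_eq distrib_left)
  also have "\<dots> = (\<Sum>d=1..Suc n. mangoldt d * real (n div d)) + (\<Sum>d=1..Suc n. if d dvd Suc n then mangoldt d else 0)"
    by (rule sum.distrib)
  also have "(\<Sum>d=1..Suc n. mangoldt d * real (n div d)) = ln (fact n)"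
    using Suc by simp
  also have "(\<Sum>d=1..Suc n. if d dvd Suc n then mangoldt d else 0) = (\<Sum>d | d dvd Suc n. mangoldt d)"
    by (intro sum.mono_neutral_cong_right) (auto dest: dvd_imp_le intro: dvd_pos_nat[of "Suc n"] simp: Suc_le_eq)
  also have "\<dots> = ln (real (Suc n))" using mangoldt_sum[of "Suc n", where ?'a = real] by simp
  finally show ?case by (simp add: ln_mult)
qed auto

text \<open>The logarithm of the central binomial coefficient is the sum of
  \<open>mangoldt d\<close> with the weights \<open>2 * n div d - 2 * (n div d)\<close>. They are
  nonnegative, and equal to 1 for \<open>n < d \<le> 2 * n\<close>, while the coefficient is at most
  \<open>2 ^ (2 * n)\<close>.\<close>

lemma chebyshev_psi_double: "chebyshev_psi (2 * n) - chebyshev_psi n \<le> 2 * real n * ln 2"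
proof -
  have ext: "ln (fact n) = (\<Sum>d=1..2*n. mangoldt d * real (n div d))"
    unfolding ln_fact_eq_sum_mangoldt by (intro sum.mono_neutral_left) auto
  have "chebyshev_psi (2 * n) - chebyshev_psi n = (\<Sum>d\<in>{1..2*n} - {1..n}. mangoldt d)"
    unfolding chebyshev_psi_def by (subst sum_diff) auto
  also have "\<dots> = (\<Sum>d\<in>{1..2*n} - {1..n}. mangoldt d * (real (2 * n div d) - 2 * real (n div d)))"
  proof (rule sum.cong[OF refl])
    fix d assume "d \<in> {1..2*n} - {1..n}"
    hence d: "n < d" "d \<le> 2 * n" by auto
    hence "2 * n div d = 1" by (intro div_nat_eqI) auto
    thus "mangoldt d = mangoldt d * (real (2 * n div d) - 2 * real (n div d))" using d by simp
  qed
  also have "\<dots> \<le> (\<Sum>d=1..2*n. mangoldt d * (real (2 * n div d) - 2 * real (n div d)))"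
  proof (intro sum_mono2 mult_nonneg_nonneg mangoldt_nonneg)
    fix d
    have "2 * (n div d) \<le> 2 * n div d"
    proof (cases "d = 0")
      case False
      thus ?thesis
        by (subst less_eq_div_iff_mult_less_eq) (simp_all add: mult.assoc)
    qed auto
    thus "0 \<le> real (2 * n div d) - 2 * real (n div d)" by linarith
  qed auto
  also have "\<dots> = ln (fact (2 * n)) - 2 * ln (fact n)"
    by (subst ext, subst ln_fact_eq_sum_mangoldt) (simp add: right_diff_distrib sum_subtractf sum_distrib_left mult_ac)
  also have "\<dots> = ln (real ((2 * n) choose n))"
    by (simp add: binomial_fact ln_div ln_mult)
  also have "\<dots> \<le> ln (2 ^ (2 * n))"
  proof -
    have "real ((2 * n) choose n) \<le> 2 ^ (2 * n)"
      using binomial_le_pow2[of "2 * n" n] by (metis of_nat_le_iff of_nat_numeral of_nat_power)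
    thus ?thesis by (subst ln_le_cancel_iff) auto
  qed
  also have "\<dots> = 2 * real n * ln 2" by (subst ln_realpow) auto
  finally show ?thesis .
qed

text \<open>Induction by halving: since \<open>ln 2 < 1\<close>, doubling \<open>m\<close> costs at
  most \<open>2 * m\<close>. The constant 4 leaves another \<open>2 * m\<close> in reserve, which
  absorbs the extra term \<open>mangoldt n\<close> for odd \<open>n\<close>.\<close>

lemma chebyshev_psi_le: "chebyshev_psi n \<le> 4 * real n"
proof (induction n rule: less_induct)
  case (less n)
  show ?case
  proof (cases "n \<le> 1")
    case True
    hence "n = 0 \<or> n = 1" by auto
    thus ?thesis by (auto simp: chebyshev_psi_def)
  next
    case False
    define m where "m = n div 2"
    have m: "m < n" using False by (simp add: m_def)
    have dbl: "chebyshev_psi (2 * m) \<le> chebyshev_psi m + 2 * real m"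
    proof -
      have "2 * real m * ln 2 \<le> 2 * real m * 1"
        using ln_2_less_1 by (intro mult_left_mono) auto
      thus ?thesis using chebyshev_psi_double[of m] by simp
    qed
    have "n = 2 * m \<or> n = Suc (2 * m)" by (auto simp: m_def)
    thus ?thesis
    proof
      assume "n = 2 * m"
      thus ?thesis using dbl less.IH[OF m] by simp
    next
      assume n: "n = Suc (2 * m)"
      have "chebyshev_psi n = chebyshev_psi (2 * m) + mangoldt n" by (simp add: chebyshev_psi_def n)
      also have "mangoldt n \<le> ln (real n)" using n by (intro mangoldt_le) auto
      also have "ln (real n) \<le> 2 * real m" using ln_add_one_self_le_self[of "2 * real m"] n by simp
      finally show ?thesis using dbl less.IH[OF m] n by simp
    qed
  qed
qed

lemma finite_primes_le: "finite {p :: nat. prime p \<and> real p \<le> x}"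
  by (rule finite_subset[of _ "{..nat \<lfloor>x\<rfloor>}"]) (auto simp: le_nat_floor)

text \<open>Grouping prime powers by their prime, each \<open>p\<close> has at most
  \<open>ln n / ln p\<close> powers up to \<open>n\<close>, each of weight \<open>ln p\<close>, so
  it contributes at most \<open>ln n\<close>.\<close>

lemma chebyshev_psi_le_prime_pi: "chebyshev_psi n \<le> real (prime_pi (real n)) * ln (real n)"
proof -
  define P where "P = {p :: nat. prime p \<and> real p \<le> real n}"
  define T where "T = {k \<in> {1..n}. primepow k}"
  have finP: "finite P" unfolding P_def by (rule finite_primes_le)
  have "chebyshev_psi n = (\<Sum>k\<in>T. ln (real (aprimedivisor k)))"
    unfolding chebyshev_psi_def T_def by (intro sum.mono_neutral_cong_right) (auto simp: mangoldt_def)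
  also have "\<dots> = (\<Sum>p\<in>P. \<Sum>k | k \<in> T \<and> aprimedivisor k = p. ln (real (aprimedivisor k)))"
  proof (rule sum.group[symmetric])
    show "aprimedivisor ` T \<subseteq> P"
    proof
      fix p assume "p \<in> aprimedivisor ` T"
      then obtain k where k: "p = aprimedivisor k" "k \<le> n" "primepow k" by (auto simp: T_def)
      have "k > 1" using primepow_gt_Suc_0[OF k(3)] by simp
      thus "p \<in> P" using k prime_aprimedivisor'[of k] aprimedivisor_le_nat[of k] by (auto simp: P_def)
    qed
  qed (auto simp: finP T_def)
  also have "\<dots> \<le> (\<Sum>p\<in>P. ln (real n))"
  proof (rule sum_mono)
    fix p assume "p \<in> P"
    hence p: "prime p" "p \<le> n" by (auto simp: P_def)
    hence lnp: "ln (real p) > 0" using prime_gt_1_nat[of p] by simp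
    have n: "n > 0" using p prime_gt_0_nat[of p] by simp
    define J where "J = nat \<lfloor>ln (real n) / ln (real p)\<rfloor>"
    have sub: "{k. k \<in> T \<and> aprimedivisor k = p} \<subseteq> (\<lambda>j. p ^ j) ` {1..J}"
    proof
      fix k assume "k \<in> {k. k \<in> T \<and> aprimedivisor k = p}"
      hence k: "k \<le> n" "primepow k" "aprimedivisor k = p" by (auto simp: T_def)
      then obtain q j where qj: "prime q" "j > 0" "k = q ^ j" by (auto simp: primepow_def)
      hence "q = p" using k by (simp add: aprimedivisor_prime_power)
      have "real p ^ j \<le> real n" using k qj \<open>q = p\<close> by (metis of_nat_le_iff of_nat_power)
      hence "ln (real p ^ j) \<le> ln (real n)" using p n prime_gt_0_nat[of p] by (subst ln_le_cancel_iff) auto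
      hence "real j * ln (real p) \<le> ln (real n)" using p prime_gt_0_nat[of p] by (simp add: ln_realpow)
      hence "real j \<le> ln (real n) / ln (real p)" using lnp by (simp add: field_simps)
      hence "j \<le> J" unfolding J_def by (rule le_nat_floor)
      thus "k \<in> (\<lambda>j. p ^ j) ` {1..J}" using qj \<open>q = p\<close> by auto
    qed
    have "card {k. k \<in> T \<and> aprimedivisor k = p} \<le> J"
      using card_mono[OF _ sub] card_image_le[of "{1..J}" "\<lambda>j. p ^ j"] by simp
    moreover have "real J \<le> ln (real n) / ln (real p)"
      unfolding J_def using n lnp by (intro of_nat_floor) auto
    ultimately have "real (card {k. k \<in> T \<and> aprimedivisor k = p}) \<le> ln (real n) / ln (real p)"
      by linarith
    hence "real (card {k. k \<in> T \<and> aprimedivisor k = p}) * ln (real p) \<le> ln (real n)"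
      using lnp by (simp add: field_simps)
    thus "(\<Sum>k | k \<in> T \<and> aprimedivisor k = p. ln (real (aprimedivisor k))) \<le> ln (real n)"
      by simp
  qed
  also have "\<dots> = real (prime_pi (real n)) * ln (real n)"
    by (simp add: prime_pi_def P_def)
  finally show ?thesis .
qed

lemma prime_pi_le_self: "x \<ge> 0 \<Longrightarrow> real (prime_pi x) \<le> x"
proof -
  assume x: "x \<ge> 0"
  have "prime_pi x \<le> card {1..nat \<lfloor>x\<rfloor>}"
    unfolding prime_pi_def by (intro card_mono) (auto simp: le_nat_floor Suc_le_eq prime_gt_0_nat)
  thus ?thesis using x by simp linarith
qed

lemma prime_pi_mono: "x \<le> y \<Longrightarrow> prime_pi x \<le> prime_pi y"
  unfolding prime_pi_def by (intro card_mono finite_primes_le) auto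

text \<open>Every prime above \<open>y\<close> contributes at least \<open>ln y\<close> to
  \<open>chebyshev_psi n\<close>, and there are at most \<open>y\<close> others. The threshold stays
  free so that it can later be optimised against \<open>n\<close>.\<close>

lemma prime_pi_le_chebyshev_psi:
  assumes y: "y > 1"
  shows "real (prime_pi (real n)) \<le> y + chebyshev_psi n / ln y"
proof -
  define Q where "Q = {p :: nat. prime p \<and> real p \<le> real n \<and> real p > y}"
  have finQ: "finite Q" unfolding Q_def by (rule finite_subset[OF _ finite_primes_le[of "real n"]]) auto
  have "prime_pi (real n) \<le> card ({p. prime p \<and> real p \<le> y} \<union> Q)"
    unfolding prime_pi_def by (intro card_mono finite_UnI finite_primes_le finQ) (auto simp: Q_def)
  also have "\<dots> \<le> prime_pi y + card Q" unfolding prime_pi_def by (rule card_Un_le)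
  finally have *: "real (prime_pi (real n)) \<le> real (prime_pi y) + real (card Q)" by linarith
  have "real (card Q) * ln y = (\<Sum>p\<in>Q. ln y)" by simp
  also have "\<dots> \<le> (\<Sum>p\<in>Q. mangoldt p)"
  proof (rule sum_mono)
    fix p assume "p \<in> Q"
    hence "prime p" "real p > y" by (auto simp: Q_def)
    thus "ln y \<le> mangoldt p" using y by simp
  qed
  also have "\<dots> \<le> chebyshev_psi n"
    unfolding chebyshev_psi_def by (intro sum_mono2 mangoldt_nonneg) (auto simp: Q_def prime_ge_1_nat Suc_leI prime_gt_0_nat)
  finally have "real (card Q) \<le> chebyshev_psi n / ln y" using y by (simp add: field_simps)
  thus ?thesis using * prime_pi_le_self[of y] y by linarith
qed

subsection \<open>Non-vanishing of the zeta function\<close>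

lemma norm_of_nat_powr: "norm ((of_nat n :: complex) powr s) = real n powr Re s"
  using norm_powr_real_powr[of "of_nat n" s] by simp

lemma has_vector_derivative_of_real_powr:
  "t > 0 \<Longrightarrow> ((\<lambda>t. of_real t powr s) has_vector_derivative (s * of_real t powr (s - 1))) (at t within A)"
  for s :: complex
  by (intro has_vector_derivative_real_field has_field_derivative_powr) auto

text \<open>A mean value inequality with a comparison function instead of a constant: for
  \<open>norm_powr_slope_le\<close> the bound must be a difference of powers, so that it
  telescopes.\<close>

lemma norm_of_real_powr_diff_le:
  fixes s :: complex
  assumes ab: "0 < a" "a < b"
    and \<phi>: "\<And>t. a \<le> t \<Longrightarrow> t \<le> b \<Longrightarrow> (\<phi> has_real_derivative \<phi>' t) (at t)"
    and bound: "\<And>t. a < t \<Longrightarrow> t < b \<Longrightarrow> norm s * t powr (Re s - 1) \<le> \<phi>' t"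
  shows "norm (of_real b powr s - of_real a powr s) \<le> \<phi> b - \<phi> a"
proof (rule differentiable_bound_general[OF ab(2), where f = "\<lambda>t. of_real t powr s" and 
      f' = "\<lambda>t. s * of_real t powr (s - 1)" and \<phi>' = \<phi>'])
  show "continuous_on {a..b} (\<lambda>t. of_real t powr s)"
    by (rule continuous_on_vector_derivative[OF has_vector_derivative_of_real_powr]) (use ab in auto)
  show "continuous_on {a..b} \<phi>"
    by (meson DERIV_isCont \<phi> atLeastAtMost_iff continuous_at_imp_continuous_on)
  show "norm (s * of_real t powr (s - 1)) \<le> \<phi>' t" if "a < t" "t < b" for t
    using bound[OF that] ab that by (simp add: norm_mult norm_powr_real_powr)
  show "((\<lambda>t. of_real t powr s) has_vector_derivative s * of_real t powr (s - 1)) (at t)" if "a < t" "t < b" for t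
    using that ab by (intro has_vector_derivative_of_real_powr) auto
  show "(\<phi> has_vector_derivative \<phi>' t) (at t)" if "a < t" "t < b" for t
    using \<phi>[of t] that by (simp add: has_real_derivative_iff_has_vector_derivative)
qed

section \<open>Continuation of the zeta function to the right half plane\<close>

definition zeta_term :: "nat \<Rightarrow> complex \<Rightarrow> complex" where
  "zeta_term k s = (s - 1) * of_nat (Suc k) powr (-s) - of_nat (Suc k) powr (1 - s) + of_nat (Suc (Suc k)) powr (1 - s)"

text \<open>\<open>zeta_reg s\<close> is \<open>(s - 1) \<zeta>(s)\<close>; \<open>zeta_term\<close> is \<open>s - 1\<close> times the difference between
  \<open>n\<close> to the \<open>-s\<close> and the integral of \<open>t\<close> to the \<open>-s\<close> over \<open>[n, n + 1]\<close>, where \<open>n = k + 1\<close>. This makes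
  the series converge for \<open>Re s > 0\<close>.\<close>

definition zeta_reg :: "complex \<Rightarrow> complex" where
  "zeta_reg s = 1 + (\<Sum>k. zeta_term k s)"

text \<open>The mean value inequality is used twice. The term is the increment over
  \<open>[n, n + 1]\<close> of a function \<open>F\<close> with derivative
  \<open>(s - 1) * (n powr (-s) - t powr (-s))\<close>, and this difference is itself an increment
  over a length of at most 1. The exponent thus drops to \<open>- Re s - 1\<close>, which is below
  -1 once \<open>Re s > 0\<close>.\<close>

lemma norm_zeta_term_le:
  assumes "Re s \<ge> 0"
  shows "norm (zeta_term k s) \<le> norm (s - 1) * norm s * real (Suc k) powr (- Re s - 1)"
proof -
  define n where "n = real (Suc k)"
  have n: "n \<ge> 1" by (simp add: n_def)
  have inner: "norm (of_real t powr (-s) - of_real n powr (-s)) \<le> norm s * n powr (- Re s - 1)" if t: "n < t" "t < n + 1" for t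
  proof -
    define c where "c = norm s * n powr (- Re s - 1)"
    have "norm (of_real t powr (-s) - of_real n powr (-s)) \<le> c * t - c * n"
    proof (rule norm_of_real_powr_diff_le[where \<phi>' = "\<lambda>_. c"])
      fix u assume u: "n < u" "u < t"
      have "u powr (- Re s - 1) \<le> n powr (- Re s - 1)"
        using u n assms by (intro powr_mono2') auto
      thus "norm (-s) * u powr (Re (-s) - 1) \<le> c" by (simp add: c_def mult_left_mono)
    qed (use n t in \<open>auto intro!: derivative_eq_intros\<close>)
    also have "\<dots> = c * (t - n)" by (simp add: algebra_simps)
    also have "\<dots> \<le> c * 1" using t by (intro mult_left_mono) (auto simp: c_def)
    finally show ?thesis by (simp add: c_def)
  qed
  define F where "F = (\<lambda>t. (s - 1) * of_real n powr (-s) * of_real t + of_real t powr (1 - s))"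
  define c where "c = norm (s - 1) * norm s * n powr (- Re s - 1)"
  have dF: "(F has_vector_derivative ((s - 1) * of_real n powr (-s) + (1 - s) * of_real t powr (1 - s - 1))) (at t within A)"
    if "t > 0" for t A
    unfolding F_def using has_vector_derivative_of_real_powr[OF that, of "1 - s" A]
    by (auto intro!: derivative_eq_intros)
  have "norm (F (n + 1) - F n) \<le> c * (n + 1) - c * n"
  proof (rule differentiable_bound_general[where f = F and \<phi>' = "\<lambda>_. c" and \<phi> = "\<lambda>t. c * t" and
       f' = "\<lambda>t. (s - 1) * of_real n powr (-s) + (1 - s) * of_real t powr (1 - s - 1)"])
    show "continuous_on {n..n+1} F"
      by (rule continuous_on_vector_derivative[OF dF]) (use n in auto)
    fix t assume t: "n < t" "t < n + 1"
    show "(F has_vector_derivative ((s - 1) * of_real n powr (-s) + (1 - s) * of_real t powr (1 - s - 1))) (at t)"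
      using t n by (intro dF) auto
    have "norm ((s - 1) * of_real n powr (-s) + (1 - s) * of_real t powr (1 - s - 1)) =
          norm ((1 - s) * (of_real t powr (-s) - of_real n powr (-s)))"
      by (simp add: algebra_simps)
    also have "\<dots> = norm (s - 1) * norm (of_real t powr (-s) - of_real n powr (-s))"
      by (simp add: norm_mult norm_minus_commute)
    also have "\<dots> \<le> c"
      unfolding c_def mult.assoc using inner[OF t] by (intro mult_left_mono) auto
    finally show "norm ((s - 1) * of_real n powr (-s) + (1 - s) * of_real t powr (1 - s - 1)) \<le> c" .
    show "((*) c has_vector_derivative c) (at t)"
      by (auto intro!: derivative_eq_intros simp: has_real_derivative_iff_has_vector_derivative[symmetric])
  qed (auto intro!: continuous_intros)
  also have "F (n + 1) - F n = zeta_term k s"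
    by (simp add: F_def zeta_term_def n_def algebra_simps)
  finally show ?thesis by (simp add: c_def n_def algebra_simps)
qed

lemma zeta_term_holomorphic: "zeta_term k holomorphic_on A"
  unfolding zeta_term_def by (intro holomorphic_intros) (auto simp: of_nat_eq_0_iff simp del: of_nat_Suc)

lemma summable_Suc_powr: "a < -1 \<Longrightarrow> summable (\<lambda>k. real (Suc k) powr a)"
  using summable_real_powr_iff[of a] by (subst summable_Suc_iff) auto

lemma zeta_term_bound_cball:
  assumes "Re x > 0" "y \<in> cball x (Re x / 2)"
  shows "norm (zeta_term k y) \<le> (norm x + Re x / 2 + 1) * (norm x + Re x / 2) * real (Suc k) powr (- (Re x / 2) - 1)"
    and "Re y > 0"
proof -
  have d: "norm (x - y) \<le> Re x / 2" using assms by (simp add: dist_norm)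
  have Re: "Re y \<ge> Re x / 2" using abs_Re_le_cmod[of "x - y"] d by simp
  thus "Re y > 0" using assms by simp
  have n: "norm y \<le> norm x + Re x / 2" using norm_triangle_ineq4[of x "x - y"] d by simp
  have "norm (zeta_term k y) \<le> norm (y - 1) * norm y * real (Suc k) powr (- Re y - 1)"
    using Re assms by (intro norm_zeta_term_le) auto
  also have "\<dots> \<le> (norm x + Re x / 2 + 1) * (norm x + Re x / 2) * real (Suc k) powr (- (Re x / 2) - 1)"
  proof (intro mult_mono n powr_mono)
    show "norm (y - 1) \<le> norm x + Re x / 2 + 1" using n norm_triangle_ineq4[of y 1] by simp
  qed (use Re assms in \<open>auto intro!: add_nonneg_nonneg mult_nonneg_nonneg\<close>)
  finally show "norm (zeta_term k y) \<le> (norm x + Re x / 2 + 1) * (norm x + Re x / 2) * real (Suc k) powr (- (Re x / 2) - 1)" .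
qed

lemma zeta_reg_holomorphic: "zeta_reg holomorphic_on {s. Re s > 0}"
proof -
  have "(\<lambda>s. \<Sum>k. zeta_term k s) holomorphic_on {s. Re s > 0}"
  proof (rule holomorphic_uniform_sequence[where f = "\<lambda>n s. \<Sum>k<n. zeta_term k s"])
    show "(\<lambda>s. \<Sum>k<n. zeta_term k s) holomorphic_on {s. Re s > 0}" for n
      by (intro holomorphic_intros zeta_term_holomorphic)
    fix x :: complex assume "x \<in> {s. Re s > 0}"
    hence x: "Re x > 0" by simp
    have "uniform_limit (cball x (Re x / 2)) (\<lambda>n s. \<Sum>k<n. zeta_term k s) (\<lambda>s. \<Sum>k. zeta_term k s) sequentially"
      by (rule Weierstrass_m_test[OF zeta_term_bound_cball(1)[OF x]])
         (use x in \<open>auto intro!: summable_mult summable_Suc_powr simp del: of_nat_Suc\<close>)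
    thus "\<exists>d>0. cball x d \<subseteq> {s. Re s > 0} \<and> uniform_limit (cball x d) (\<lambda>n s. \<Sum>k<n. zeta_term k s) (\<lambda>s. \<Sum>k. zeta_term k s) sequentially"
      using x zeta_term_bound_cball(2)[OF x] by (intro exI[of _ "Re x / 2"]) auto
  qed (simp add: open_halfspace_Re_gt)
  thus ?thesis unfolding zeta_reg_def by (intro holomorphic_intros)
qed

lemma zeta_reg_1: "zeta_reg 1 = 1"
  by (simp add: zeta_reg_def zeta_term_def del: of_nat_Suc)

lemma tendsto_of_nat_Suc_powr_0:
  assumes "Re s < 0"
  shows "(\<lambda>k. of_nat (Suc k) powr s :: complex) \<longlonglongrightarrow> 0"
proof (rule tendsto_norm_zero_cancel)
  show "(\<lambda>k. norm (of_nat (Suc k) powr s :: complex)) \<longlonglongrightarrow> 0"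
    unfolding norm_of_nat_powr using assms by real_asymp
qed

text \<open>Dirichlet series are summed over all naturals: the term at \<open>n = 0\<close> vanishes because \<open>0 powr s = 0\<close>.\<close>

lemma zeta_reg_conv_series:
  assumes s: "Re s > 1"
  shows "(\<lambda>n. of_nat n powr (-s)) sums (zeta_reg s / (s - 1))"
proof -
  have s1: "s \<noteq> 1" using s by auto
  have "summable (\<lambda>k. zeta_term k s)"
    by (rule summable_comparison_test'[OF _ zeta_term_bound_cball(1)[of s s]])
       (use s in \<open>auto intro!: summable_mult summable_Suc_powr simp del: of_nat_Suc\<close>)
  hence 1: "(\<lambda>k. zeta_term k s) sums (zeta_reg s - 1)"
    unfolding zeta_reg_def by (simp add: summable_sums)
  \<comment> \<open>The value 1 of this telescoping series is the summand 1 in the definition of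
    \<open>zeta_reg\<close>.\<close>
  have 2: "(\<lambda>k. of_nat (Suc k) powr (1 - s) - of_nat (Suc (Suc k)) powr (1 - s)) sums (of_nat (Suc 0) powr (1 - s) - 0)"
    by (rule telescope_sums'[OF tendsto_of_nat_Suc_powr_0]) (use s in auto)
  have "(\<lambda>k. (s - 1) * of_nat (Suc k) powr (-s)) sums zeta_reg s"
    using sums_add[OF 1 2] by (simp add: zeta_term_def)
  hence "(\<lambda>k. (s - 1) * of_nat (Suc k) powr (-s) / (s - 1)) sums (zeta_reg s / (s - 1))"
    by (rule sums_divide)
  hence "(\<lambda>k. of_nat (Suc k) powr (-s)) sums (zeta_reg s / (s - 1))"
    using s1 by simp
  thus ?thesis by (subst (asm) sums_Suc_iff) simp
qed

section \<open>Dirichlet series of the logarithm and of the von Mangoldt function\<close>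

lemma summable_ln_powr:
  assumes "a > 1"
  shows "summable (\<lambda>n. ln (real n) * real n powr (-a))"
proof (rule summable_comparison_test')
  define b where "b = (a - 1) / 2"
  have b: "b > 0" using assms by (simp add: b_def)
  show "summable (\<lambda>n. (1 / b) * real n powr (b - a))"
    using assms by (intro summable_mult) (simp add: summable_real_powr_iff b_def field_simps)
  fix n :: nat assume n: "n \<ge> 1"
  have "ln (real n) * real n powr (-a) \<le> (real n powr b / b) * real n powr (-a)"
    using n b by (intro mult_right_mono ln_powr_bound) auto
  also have "\<dots> = (1 / b) * real n powr (b - a)"
    by (simp add: powr_diff powr_minus field_simps)
  finally show "norm (ln (real n) * real n powr (-a)) \<le> (1 / b) * real n powr (b - a)"
    using n by simp
qed

text \<open>Termwise differentiation, which makes the derivative of the zeta function comparable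
  with the product of Dirichlet series below. \<open>Z\<close> is identified with
  \<open>zeta_reg s / (s - 1)\<close> afterwards by uniqueness of sums.\<close>

lemma zeta_series_differentiable:
  "\<exists>Z. \<forall>s. Re s > 1 \<longrightarrow> (\<lambda>n. of_nat n powr (-s)) sums Z s \<and>
     (\<lambda>n. - (of_real (ln (real n)) * of_nat n powr (-s))) sums deriv Z s \<and> Z field_differentiable at s"
proof -
  have "\<exists>Z Z'. \<forall>s\<in>{s. Re s > 1}. (\<lambda>n. of_nat n powr (-s)) sums Z s \<and>
     (\<lambda>n. - (of_real (ln (real n)) * of_nat n powr (-s))) sums Z' s \<and> (Z has_field_derivative Z' s) (at s)"
  proof (rule series_and_derivative_comparison_local)
    show "open {s. Re s > 1}" by (simp add: open_halfspace_Re_gt)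
    fix s :: complex assume s: "s \<in> {s. Re s > 1}"
    show "((\<lambda>s. of_nat n powr - s) has_field_derivative - (of_real (ln (real n)) * of_nat n powr - s)) (at s)" for n
    proof (cases "n = 0")
      case False
      hence eq: "of_nat n powr - s = exp (- s * of_real (ln (real n)))" for s :: complex
        by (simp add: powr_def Ln_of_nat)
      show ?thesis unfolding eq by (auto intro!: derivative_eq_intros)
    qed auto
    define d where "d = (Re s - 1) / 2"
    show "\<exists>d h. 0 < d \<and> summable h \<and> (\<forall>\<^sub>F n in sequentially. \<forall>y\<in>ball s d \<inter> {s. 1 < Re s}. norm (of_nat n powr - y) \<le> h n)"
    proof (intro exI conjI always_eventually allI ballI)
      show "d > 0" using s by (simp add: d_def)
      show "summable (\<lambda>n. real n powr (-1 - d))"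
        using s by (simp add: summable_real_powr_iff d_def)
      fix n y assume "y \<in> ball s d \<inter> {s. 1 < Re s}"
      hence "norm (s - y) < d" by (simp add: dist_norm)
      hence "Re y \<ge> 1 + d" using abs_Re_le_cmod[of "s - y"] by (simp add: d_def field_simps)
      thus "norm (of_nat n powr - y) \<le> real n powr (-1 - d)"
        unfolding norm_of_nat_powr by (cases "n = 0") (auto intro!: powr_mono)
    qed
  qed
  then obtain Z Z' where "\<And>s. Re s > 1 \<Longrightarrow> (\<lambda>n. of_nat n powr (-s)) sums Z s"
     "\<And>s. Re s > 1 \<Longrightarrow> (\<lambda>n. - (of_real (ln (real n)) * of_nat n powr (-s))) sums Z' s"
     "\<And>s. Re s > 1 \<Longrightarrow> (Z has_field_derivative Z' s) (at s)"
    by auto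
  moreover from this(3) have "\<And>s. Re s > 1 \<Longrightarrow> deriv Z s = Z' s" by (intro DERIV_imp_deriv)
  ultimately show ?thesis by (intro exI[of _ Z]) (auto simp: field_differentiable_def)
qed

lemma summable_mangoldt_powr: "a > 1 \<Longrightarrow> summable (\<lambda>n. mangoldt n * real n powr (-a))"
proof (rule summable_comparison_test'[OF summable_ln_powr])
  fix n :: nat assume "n \<ge> 1"
  hence "mangoldt n \<le> ln (real n)" by (intro mangoldt_le) auto
  thus "norm (mangoldt n * real n powr (-a)) \<le> ln (real n) * real n powr (-a)"
    using mangoldt_nonneg by (simp add: abs_mult mult_right_mono)
qed

definition mangoldt_series :: "complex \<Rightarrow> complex" where
  "mangoldt_series s = (\<Sum>n. mangoldt n * of_nat n powr (-s))"

lemma summable_norm_mangoldt_series: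
  "Re s > 1 \<Longrightarrow> summable (\<lambda>n. norm (mangoldt n * of_nat n powr (-s) :: complex))"
  using summable_mangoldt_powr[of "Re s"] by (simp add: norm_mult norm_of_nat_powr)

lemma mangoldt_series_sums:
  "Re s > 1 \<Longrightarrow> (\<lambda>n. mangoldt n * of_nat n powr (-s)) sums mangoldt_series s"
  unfolding mangoldt_series_def by (rule summable_sums[OF summable_norm_cancel[OF summable_norm_mangoldt_series]])

text \<open>The Dirichlet convolution of \<open>mangoldt\<close> with 1 is \<open>ln\<close>. Both
  series converge absolutely, so the double series over \<open>(m, n)\<close> may be regrouped by
  the product \<open>N = m * n\<close>.\<close>

lemma mangoldt_series_mult_zeta:
  assumes s: "Re s > 1" and Z: "(\<lambda>n. of_nat n powr (-s)) sums Z"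
  shows "(\<lambda>n. of_real (ln (real n)) * of_nat n powr (-s)) sums (mangoldt_series s * Z)"
proof -
  define f where "f = (\<lambda>n. mangoldt n * of_nat n powr (-s) :: complex)"
  define g where "g = (\<lambda>n. of_nat n powr (-s) :: complex)"
  have sum_f: "summable (\<lambda>n. norm (f n))" unfolding f_def by (rule summable_norm_mangoldt_series[OF s])
  have sum_g: "summable (\<lambda>n. norm (g n))"
    unfolding g_def norm_of_nat_powr using s by (simp add: summable_real_powr_iff)
  \<comment> \<open>Index 0 has to go before regrouping: every number divides 0, so its fibre would
    be infinite.\<close>
  have pos: "(h has_sum S) {1..}" if "h sums S" "summable (\<lambda>n. norm (h n))" "h 0 = 0" for h :: "nat \<Rightarrow> complex" and S
  proof -
    have "(h has_sum S) UNIV" using norm_summable_imp_has_sum[OF that(2,1)] .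
    thus ?thesis by (rule has_sum_cong_neutral[THEN iffD1, rotated -1]) (use that(3) in \<open>auto simp: not_less_eq_eq\<close>)
  qed
  have f: "(f has_sum mangoldt_series s) {1..}"
    by (rule pos[OF _ sum_f]) (use mangoldt_series_sums[OF s] in \<open>auto simp: f_def\<close>)
  have g: "(g has_sum Z) {1..}"
    by (rule pos[OF _ sum_g]) (use Z in \<open>auto simp: g_def\<close>)
  have nf: "(\<lambda>n. norm (f n)) summable_on {1..}" and ng: "(\<lambda>n. norm (g n)) summable_on {1..}"
    using sum_f sum_g by (auto intro!: summable_on_subset_banach[OF norm_summable_imp_summable_on])
  have "(\<lambda>(m, n). f m * g n) summable_on {1..} \<times> {1..}"
  proof (rule abs_summable_summable, rule summable_on_SigmaI)
    fix m :: nat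
    show "((\<lambda>n. norm (case (m, n) of (m, n) \<Rightarrow> f m * g n)) has_sum (norm (f m) * infsum (\<lambda>n. norm (g n)) {1..})) {1..}"
      using has_sum_cmult_right[OF has_sum_infsum[OF ng], of "norm (f m)"] by (simp add: norm_mult)
    show "(\<lambda>m. norm (f m) * infsum (\<lambda>n. norm (g n)) {1..}) summable_on {1..}"
      using nf by (rule summable_on_cmult_left)
  qed auto
  hence "((\<lambda>(m, n). f m * g n) has_sum (mangoldt_series s * Z)) ({1..} \<times> {1..})"
    by (rule has_sum_SigmaI[rotated 2]) 
       (use has_sum_cmult_right[OF g] has_sum_cmult_left[OF f] in auto)
  also have "?this \<longleftrightarrow> ((\<lambda>(N, d). mangoldt d * of_nat N powr (-s)) has_sum (mangoldt_series s * Z)) (SIGMA N:{1..}. {d. d dvd N})"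
  proof (rule has_sum_reindex_bij_witness[where i = "\<lambda>(N, d). (d, N div d)" and j = "\<lambda>(m, n). (m * n, m)"])
    fix a :: "nat \<times> nat" assume "a \<in> {1..} \<times> {1..}"
    thus "(case (case a of (m, n) \<Rightarrow> (m * n, m)) of (N, d) \<Rightarrow> mangoldt d * of_nat N powr (-s)) = (case a of (m, n) \<Rightarrow> f m * g n)"
      by (auto simp: f_def g_def powr_times_real mult_ac split: prod.splits)
  qed (auto simp: dvd_div_eq_0_iff Suc_le_eq intro!: Nat.gr0I elim!: dvdE)
  finally have sig: "((\<lambda>(N, d). mangoldt d * of_nat N powr (-s)) has_sum (mangoldt_series s * Z)) (SIGMA N:{1..}. {d. d dvd N})" .
  have "((\<lambda>N. of_real (ln (real N)) * of_nat N powr (-s)) has_sum (mangoldt_series s * Z)) {1..}"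
  proof (rule has_sum_SigmaD[OF sig])
    fix N :: nat assume N: "N \<in> {1..}"
    have "((\<lambda>d. mangoldt d * of_nat N powr (-s) :: complex) has_sum (\<Sum>d | d dvd N. mangoldt d * of_nat N powr (-s))) {d. d dvd N}"
      using N by (intro has_sum_finite finite_divisors_nat) auto
    thus "((\<lambda>d. case (N, d) of (N, d) \<Rightarrow> mangoldt d * of_nat N powr (-s)) has_sum (of_real (ln (real N)) * of_nat N powr (-s))) {d. d dvd N}"
      using N mangoldt_sum[of N, where ?'a = complex] by (simp add: sum_distrib_right[symmetric])
  qed
  hence "((\<lambda>N. of_real (ln (real N)) * of_nat N powr (-s)) has_sum (mangoldt_series s * Z)) UNIV"
    by (rule has_sum_cong_neutral[THEN iffD1, rotated -1]) (auto simp: not_less_eq_eq)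
  thus ?thesis by (rule has_sum_imp_sums)
qed

text \<open>This is the formula for the logarithmic derivative of zeta, multiplied out so that it
  can be stated before non-vanishing is known.\<close>

lemma mangoldt_series_mult_zeta_reg:
  assumes s: "Re s > 1"
  shows "mangoldt_series s * zeta_reg s = zeta_reg s / (s - 1) - deriv zeta_reg s"
proof -
  obtain Z where Z: "\<And>s. Re s > 1 \<Longrightarrow> (\<lambda>n. of_nat n powr (-s)) sums Z s"
     "\<And>s. Re s > 1 \<Longrightarrow> (\<lambda>n. - (of_real (ln (real n)) * of_nat n powr (-s))) sums deriv Z s"
     "\<And>s. Re s > 1 \<Longrightarrow> Z field_differentiable at s"
    using zeta_series_differentiable by blast
  have s1: "s \<noteq> 1" using s by auto
  have Z_eq: "zeta_reg w = (w - 1) * Z w" if "Re w > 1" for w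
  proof -
    have "w \<noteq> 1" using that by auto
    thus ?thesis using sums_unique2[OF zeta_reg_conv_series[OF that] Z(1)[OF that]] by (simp add: field_simps)
  qed
  have "(\<lambda>n. - (of_real (ln (real n)) * of_nat n powr (-s))) sums - (mangoldt_series s * Z s)"
    by (intro sums_minus mangoldt_series_mult_zeta s Z)
  hence dZ: "deriv Z s = - (mangoldt_series s * Z s)"
    using Z(2)[OF s] sums_unique2 by blast
  have "((\<lambda>w. (w - 1) * Z w) has_field_derivative (Z s + (s - 1) * deriv Z s)) (at s)"
    using field_differentiable_derivI[OF Z(3)[OF s]] by (auto intro!: derivative_eq_intros)
  hence "(zeta_reg has_field_derivative (Z s + (s - 1) * deriv Z s)) (at s)"
    by (rule has_field_derivative_transform_within_open[where S = "{s. Re s > 1}"])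
       (use s Z_eq in \<open>auto simp: open_halfspace_Re_gt\<close>)
  hence "deriv zeta_reg s = Z s + (s - 1) * deriv Z s" by (rule DERIV_imp_deriv)
  moreover have "zeta_reg s / (s - 1) = Z s" using s1 by (simp add: Z_eq[OF s])
  ultimately show ?thesis by (simp add: dZ Z_eq[OF s] algebra_simps)
qed

section \<open>Orders of zeros and the 3-4-1 argument\<close>

lemma log_deriv_limit:
  assumes holf: "f holomorphic_on S" and S: "open S" "connected S" "a \<in> S" and nz: "\<exists>w\<in>S. f w \<noteq> 0"
  shows "\<exists>m::nat. (f a = 0 \<longleftrightarrow> m > 0) \<and> ((\<lambda>w. (w - a) * deriv f w / f w) \<longlongrightarrow> of_nat m) (at a) \<and>
           eventually (\<lambda>w. f w \<noteq> 0) (at a)"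
proof -
  \<comment> \<open>Near \<open>a\<close> one has \<open>f w = g w * (w - a) ^ m\<close> with
    \<open>g a \<noteq> 0\<close>, so the logarithmic derivative of \<open>f\<close> is
    \<open>m / (w - a)\<close> plus a function continuous at \<open>a\<close>. The case
    \<open>m = 0\<close> is included.\<close>
  define m where "m = nat (zorder f a)"
  define g where "g = zor_poly f a"
  obtain r where r: "r > 0" "cball a r \<subseteq> S" "g holomorphic_on cball a r"
      and fg: "\<And>w. w \<in> cball a r \<Longrightarrow> f w = g w * (w - a) ^ m \<and> g w \<noteq> 0"
      and m: "if f a = 0 then zorder f a > 0 else zorder f a = 0"
    using zorder_exist_zero[OF holf S nz] unfolding m_def g_def by blast
  have holg: "g holomorphic_on ball a r" using r by (meson ball_subset_cball holomorphic_on_subset)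
  have ev_ball: "eventually (\<lambda>w. w \<in> ball a r - {a}) (at a)"
    using r by (intro eventually_at_in_open) auto
  have "((\<lambda>w. (w - a) * deriv g w / g w + of_nat m) \<longlongrightarrow> (a - a) * deriv g a / g a + of_nat m) (at a)"
  proof (intro tendsto_intros)
    have "isCont (deriv g) a" "isCont g a"
      using holg r by (auto intro!: holomorphic_on_imp_continuous_on holomorphic_deriv continuous_on_interior[of "ball a r"])
    thus "(deriv g \<longlongrightarrow> deriv g a) (at a)" "(g \<longlongrightarrow> g a) (at a)" by (auto simp: isCont_def)
    show "g a \<noteq> 0" using fg[of a] r by simp
  qed
  moreover have "eventually (\<lambda>w. (w - a) * deriv g w / g w + of_nat m = (w - a) * deriv f w / f w) (at a)"
    using ev_ball
  proof eventually_elim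
    case (elim w)
    have gw: "(g has_field_derivative deriv g w) (at w)"
      using holg elim by (intro holomorphic_derivI[of _ "ball a r"]) auto
    have "((\<lambda>w. g w * (w - a) ^ m) has_field_derivative (deriv g w * (w - a) ^ m + g w * (of_nat m * (w - a) ^ (m - 1)))) (at w)"
      using gw by (auto intro!: derivative_eq_intros)
    hence "(f has_field_derivative (deriv g w * (w - a) ^ m + g w * (of_nat m * (w - a) ^ (m - 1)))) (at w)"
      by (rule has_field_derivative_transform_within_open[where S = "ball a r"]) (use elim fg in auto)
    hence df: "deriv f w = deriv g w * (w - a) ^ m + g w * (of_nat m * (w - a) ^ (m - 1))"
      by (rule DERIV_imp_deriv)
    have "(w - a) * deriv f w = (w - a) * deriv g w * (w - a) ^ m + g w * ((w - a) * (of_nat m * (w - a) ^ (m - 1)))"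
      unfolding df by (simp add: distrib_left mult_ac)
    also have "(w - a) * (of_nat m * (w - a) ^ (m - 1)) = of_nat m * (w - a) ^ m"
      by (cases m) auto
    also have "(w - a) * deriv g w * (w - a) ^ m + g w * (of_nat m * (w - a) ^ m) = ((w - a) * deriv g w / g w + of_nat m) * f w"
      using elim fg[of w] by (simp add: field_simps)
    finally show ?case using elim fg[of w] by simp
  qed
  ultimately have "((\<lambda>w. (w - a) * deriv f w / f w) \<longlongrightarrow> of_nat m) (at a)"
    by (subst (asm) tendsto_cong) auto
  moreover have "eventually (\<lambda>w. f w \<noteq> 0) (at a)"
    using ev_ball by eventually_elim (use fg in auto)
  moreover have "f a = 0 \<longleftrightarrow> m > 0" using m by (auto simp: m_def split: if_splits)
  ultimately show ?thesis by blast
qed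

text \<open>To the right of the line the series is \<open>1 / (s - 1)\<close> minus the logarithmic
  derivative of \<open>zeta_reg\<close>. After multiplication by \<open>\<epsilon>\<close> the first
  part survives only at the pole \<open>a = 1\<close>, and the second tends to the order of
  vanishing.\<close>

lemma mangoldt_series_limit:
  assumes a: "Re a \<ge> 1"
  shows "\<exists>m::nat. (zeta_reg a = 0 \<longleftrightarrow> m > 0) \<and>
           ((\<lambda>\<epsilon>. of_real \<epsilon> * mangoldt_series (a + of_real \<epsilon>)) \<longlongrightarrow> (if a = 1 then 1 else 0) - of_nat m) (at_right 0)"
proof -
  have "connected {s. Re s > 0}" by (intro convex_connected convex_halfspace_Re_gt)
  moreover have "\<exists>w\<in>{s. Re s > 0}. zeta_reg w \<noteq> 0" using zeta_reg_1 by (intro bexI[of _ 1]) auto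
  ultimately obtain m where m: "zeta_reg a = 0 \<longleftrightarrow> m > 0" 
      "((\<lambda>w. (w - a) * deriv zeta_reg w / zeta_reg w) \<longlongrightarrow> of_nat m) (at a)"
      "eventually (\<lambda>w. zeta_reg w \<noteq> 0) (at a)"
    using log_deriv_limit[OF zeta_reg_holomorphic, of a] a by (auto simp: open_halfspace_Re_gt)
  have lim: "filterlim (\<lambda>\<epsilon>::real. a + of_real \<epsilon>) (at a) (at_right 0)"
  proof (rule filterlim_atI)
    show "((\<lambda>\<epsilon>::real. a + of_real \<epsilon>) \<longlongrightarrow> a) (at_right 0)"
      by (auto intro!: tendsto_eq_intros)
    show "eventually (\<lambda>\<epsilon>::real. a + of_real \<epsilon> \<noteq> a) (at_right 0)"
      by (auto simp: eventually_at_right_less eventually_at_filter)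
  qed
  have pos: "eventually (\<lambda>\<epsilon>::real. \<epsilon> > 0) (at_right 0)" by (rule eventually_at_right_less)
  have "((\<lambda>\<epsilon>. of_real \<epsilon> / (a + of_real \<epsilon> - 1)) \<longlongrightarrow> (if a = 1 then 1 else 0)) (at_right (0::real))"
  proof (cases "a = 1")
    case True
    have "eventually (\<lambda>\<epsilon>::real. 1 = of_real \<epsilon> / (a + of_real \<epsilon> - 1)) (at_right 0)"
      using pos by eventually_elim (auto simp: True)
    thus ?thesis using True by (simp add: tendsto_eventually eventually_mono)
  next
    case False
    have "((\<lambda>\<epsilon>::real. of_real \<epsilon> / (a + of_real \<epsilon> - 1)) \<longlongrightarrow> of_real 0 / (a + of_real 0 - 1)) (at_right 0)"
      using False by (intro tendsto_intros) auto
    thus ?thesis using False by simp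
  qed
  moreover have "((\<lambda>\<epsilon>. of_real \<epsilon> * deriv zeta_reg (a + of_real \<epsilon>) / zeta_reg (a + of_real \<epsilon>)) \<longlongrightarrow> of_nat m) (at_right (0::real))"
    using filterlim_compose[OF m(2) lim] by simp
  ultimately have "((\<lambda>\<epsilon>. of_real \<epsilon> / (a + of_real \<epsilon> - 1) - of_real \<epsilon> * deriv zeta_reg (a + of_real \<epsilon>) / zeta_reg (a + of_real \<epsilon>)) 
      \<longlongrightarrow> (if a = 1 then 1 else 0) - of_nat m) (at_right (0::real))"
    by (rule tendsto_diff)
  moreover have "eventually (\<lambda>\<epsilon>. of_real \<epsilon> / (a + of_real \<epsilon> - 1) - of_real \<epsilon> * deriv zeta_reg (a + of_real \<epsilon>) / zeta_reg (a + of_real \<epsilon>)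
      = of_real \<epsilon> * mangoldt_series (a + of_real \<epsilon>)) (at_right (0::real))"
    using pos filterlim_iff[THEN iffD1, OF lim, rule_format, OF m(3)]
  proof eventually_elim
    case (elim \<epsilon>)
    define s where "s = a + of_real \<epsilon>"
    have s: "Re s > 1" using a elim by (simp add: s_def)
    have "mangoldt_series s = 1 / (s - 1) - deriv zeta_reg s / zeta_reg s"
      using mangoldt_series_mult_zeta_reg[OF s] elim by (simp add: s_def field_simps)
    thus ?case by (simp add: s_def right_diff_distrib)
  qed
  ultimately have "((\<lambda>\<epsilon>. of_real \<epsilon> * mangoldt_series (a + of_real \<epsilon>)) \<longlongrightarrow> (if a = 1 then 1 else 0) - of_nat m) (at_right 0)"
    by (subst (asm) tendsto_cong) auto
  with m(1) show ?thesis by blast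
qed

lemma norm_mangoldt_series_le:
  assumes "b > 1" "Re s \<ge> b"
  shows "norm (mangoldt_series s) \<le> (\<Sum>n. mangoldt n * real n powr (-b))"
proof (rule norm_sums_le[OF mangoldt_series_sums summable_sums[OF summable_mangoldt_powr]])
  fix n
  have "real n powr (- Re s) \<le> real n powr (-b)" using assms by (cases "n = 0") (auto intro!: powr_mono)
  thus "norm (mangoldt n * of_nat n powr (-s) :: complex) \<le> mangoldt n * real n powr (-b)"
    using mangoldt_nonneg by (simp add: norm_mult norm_of_nat_powr mult_left_mono)
qed (use assms in auto)

text \<open>The inequality holds term by term, because \<open>3 + 4 * cos \<theta> + cos (2 *
  \<theta>) = 2 * (1 + cos \<theta>)\<^sup>2\<close> with
  \<open>\<theta> = t * ln n\<close>.\<close>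

lemma mangoldt_series_341:
  assumes "b > 1"
  shows "3 * Re (mangoldt_series (of_real b)) + 4 * Re (mangoldt_series (Complex b t)) 
            + Re (mangoldt_series (Complex b (2 * t))) \<ge> 0"
proof -
  have Re_eq: "Re (mangoldt n * of_nat n powr (- Complex b u)) = mangoldt n * real n powr (-b) * cos (u * ln (real n))" for n u
  proof (cases "n = 0")
    case False
    have "(of_nat n :: complex) powr (- Complex b u) = of_real (real n powr (-b)) * cis (- (u * ln (real n)))"
      using False by (simp add: powr_def Ln_of_nat cis_conv_exp complex_eq_iff Re_exp Im_exp)
    thus ?thesis by simp
  qed auto
  have sums: "(\<lambda>n. mangoldt n * real n powr (-b) * cos (u * ln (real n))) sums Re (mangoldt_series (Complex b u))" for u
    using sums_Re[OF mangoldt_series_sums[of "Complex b u"]] assms unfolding Re_eq by simp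
  have "(\<lambda>n. 3 * (mangoldt n * real n powr (-b) * cos (0 * ln (real n))) + 4 * (mangoldt n * real n powr (-b) * cos (t * ln (real n)))
           + mangoldt n * real n powr (-b) * cos ((2 * t) * ln (real n))) sums
        (3 * Re (mangoldt_series (Complex b 0)) + 4 * Re (mangoldt_series (Complex b t)) + Re (mangoldt_series (Complex b (2 * t))))"
    by (intro sums_add sums_mult sums)
  moreover have "0 \<le> 3 * (mangoldt n * real n powr (-b) * cos (0 * ln (real n))) + 4 * (mangoldt n * real n powr (-b) * cos (t * ln (real n)))
           + mangoldt n * real n powr (-b) * cos ((2 * t) * ln (real n))" for n
  proof -
    define \<theta> where "\<theta> = t * ln (real n)"
    have "3 * (mangoldt n * real n powr (-b) * cos (0 * ln (real n))) + 4 * (mangoldt n * real n powr (-b) * cos (t * ln (real n)))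
           + mangoldt n * real n powr (-b) * cos ((2 * t) * ln (real n)) = 
          mangoldt n * real n powr (-b) * (2 * (1 + cos \<theta>)\<^sup>2)"
    proof -
      have e: "(2 * t) * ln (real n) = 2 * \<theta>" "t * ln (real n) = \<theta>" by (simp_all add: \<theta>_def)
      show ?thesis unfolding e cos_double_cos by (simp add: power2_eq_square algebra_simps)
    qed
    thus ?thesis using mangoldt_nonneg by simp
  qed
  ultimately have "0 \<le> 3 * Re (mangoldt_series (Complex b 0)) + 4 * Re (mangoldt_series (Complex b t)) + Re (mangoldt_series (Complex b (2 * t)))"
    by (rule sums_le[OF _ sums_zero, rotated]) 
  thus ?thesis by (simp add: complex_of_real_def)
qed

text \<open>A zero of order \<open>m\<close> at \<open>a\<close> makes \<open>\<epsilon> * mangoldt_series (a + \<epsilon>)\<close> tend to \<open>-m\<close>. To the right of the line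
  \<open>Re a = 1\<close> the series is bounded, so \<open>m = 0\<close>; on the line the 3-4-1 inequality gives \<open>3 - 4 m \<ge> 0\<close>.\<close>

lemma zeta_reg_nonzero:
  assumes a: "Re a \<ge> 1"
  shows "zeta_reg a \<noteq> 0"
proof (cases "Re a = 1")
  case False
  hence a1: "Re a > 1" "a \<noteq> 1" using a by auto
  obtain m :: nat where m: "zeta_reg a = 0 \<longleftrightarrow> m > 0"
     "((\<lambda>\<epsilon>. of_real \<epsilon> * mangoldt_series (a + of_real \<epsilon>)) \<longlongrightarrow> - of_nat m) (at_right 0)"
    using mangoldt_series_limit[OF a] a1 by auto
  define B where "B = (\<Sum>n. mangoldt n * real n powr (- Re a))"
  have "((\<lambda>\<epsilon>. of_real \<epsilon> * mangoldt_series (a + of_real \<epsilon>)) \<longlongrightarrow> 0) (at_right 0)"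
  proof (rule Lim_null_comparison)
    show "eventually (\<lambda>\<epsilon>. norm (of_real \<epsilon> * mangoldt_series (a + of_real \<epsilon>)) \<le> \<epsilon> * B) (at_right 0)"
      using eventually_at_right_less[of 0]
    proof eventually_elim
      case (elim \<epsilon>)
      thus ?case using norm_mangoldt_series_le[of "Re a" "a + of_real \<epsilon>"] a1
        by (simp add: norm_mult B_def mult_left_mono)
    qed
    show "((\<lambda>\<epsilon>. \<epsilon> * B) \<longlongrightarrow> 0) (at_right 0)" by (auto intro!: tendsto_eq_intros)
  qed
  from tendsto_unique[OF _ m(2) this] have "m = 0" by (simp add: trivial_limit_at_right_real)
  thus ?thesis using m by simp
next
  case True
  define t where "t = Im a"
  have a_eq: "a = Complex 1 t" using True by (simp add: t_def complex_eq_iff)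
  show ?thesis
  \<comment> \<open>For \<open>t \<noteq> 0\<close> neither \<open>Complex 1 t\<close> nor
    \<open>Complex 1 (2 * t)\<close> is the pole, so only the first of the three limits receives the
    positive contribution 1.\<close>
  proof (cases "t = 0")
    case True
    hence "a = 1" by (simp add: a_eq complex_eq_iff)
    thus ?thesis by (simp add: zeta_reg_1)
  next
    case False
    have lim: "\<exists>m::nat. (zeta_reg (Complex 1 u) = 0 \<longleftrightarrow> m > 0) \<and>
        ((\<lambda>\<epsilon>. \<epsilon> * Re (mangoldt_series (Complex (1 + \<epsilon>) u))) \<longlongrightarrow> (if u = 0 then 1 else 0) - real m) (at_right 0)" for u
    proof -
      obtain m :: nat where m: "zeta_reg (Complex 1 u) = 0 \<longleftrightarrow> m > 0" 
         "((\<lambda>\<epsilon>. of_real \<epsilon> * mangoldt_series (Complex 1 u + of_real \<epsilon>)) \<longlongrightarrow> (if Complex 1 u = 1 then 1 else 0) - of_nat m) (at_right 0)"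
        using mangoldt_series_limit[of "Complex 1 u"] by auto
      have "((\<lambda>\<epsilon>. Re (of_real \<epsilon> * mangoldt_series (Complex 1 u + of_real \<epsilon>))) \<longlongrightarrow> Re ((if Complex 1 u = 1 then 1 else 0) - of_nat m)) (at_right 0)"
        by (rule tendsto_Re[OF m(2)])
      moreover have "Complex 1 u + of_real \<epsilon> = Complex (1 + \<epsilon>) u" for \<epsilon> by (simp add: complex_eq_iff)
      moreover have "Re ((if Complex 1 u = 1 then 1 else 0) - of_nat m) = (if u = 0 then 1 else 0) - real m"
        by (simp add: complex_eq_iff)
      ultimately show ?thesis using m(1) by auto
    qed
    obtain m0 where m0: "zeta_reg (Complex 1 0) = 0 \<longleftrightarrow> m0 > 0"
        "((\<lambda>\<epsilon>. \<epsilon> * Re (mangoldt_series (Complex (1 + \<epsilon>) 0))) \<longlongrightarrow> 1 - real m0) (at_right 0)"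
      using lim[of 0] by auto
    obtain m1 where m1: "zeta_reg (Complex 1 t) = 0 \<longleftrightarrow> m1 > 0"
        "((\<lambda>\<epsilon>. \<epsilon> * Re (mangoldt_series (Complex (1 + \<epsilon>) t))) \<longlongrightarrow> - real m1) (at_right 0)"
      using lim[of t] False by auto
    obtain m2 :: nat where m2: 
        "((\<lambda>\<epsilon>. \<epsilon> * Re (mangoldt_series (Complex (1 + \<epsilon>) (2 * t)))) \<longlongrightarrow> - real m2) (at_right 0)"
      using lim[of "2 * t"] False by auto
    have "((\<lambda>\<epsilon>. 3 * (\<epsilon> * Re (mangoldt_series (Complex (1 + \<epsilon>) 0))) + 4 * (\<epsilon> * Re (mangoldt_series (Complex (1 + \<epsilon>) t)))
            + \<epsilon> * Re (mangoldt_series (Complex (1 + \<epsilon>) (2 * t)))) \<longlongrightarrow> 3 * (1 - real m0) + 4 * (- real m1) + (- real m2)) (at_right 0)"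
      by (intro tendsto_intros m0 m1 m2)
    moreover have "eventually (\<lambda>\<epsilon>. 0 \<le> 3 * (\<epsilon> * Re (mangoldt_series (Complex (1 + \<epsilon>) 0))) + 4 * (\<epsilon> * Re (mangoldt_series (Complex (1 + \<epsilon>) t)))
            + \<epsilon> * Re (mangoldt_series (Complex (1 + \<epsilon>) (2 * t)))) (at_right 0)"
      using eventually_at_right_less[of 0]
    proof eventually_elim
      case (elim \<epsilon>)
      have "0 \<le> \<epsilon> * (3 * Re (mangoldt_series (Complex (1 + \<epsilon>) 0)) + 4 * Re (mangoldt_series (Complex (1 + \<epsilon>) t))
            + Re (mangoldt_series (Complex (1 + \<epsilon>) (2 * t))))"
        using mangoldt_series_341[of "1 + \<epsilon>" t] elim by (intro mult_nonneg_nonneg) (auto simp: complex_of_real_def)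
      thus ?case by (simp add: algebra_simps)
    qed
    ultimately have "0 \<le> 3 * (1 - real m0) + 4 * (- real m1) + (- real m2)"
      by (rule tendsto_lowerbound) (simp add: trivial_limit_at_right_real)
    moreover have "real m0 \<ge> 0" "real m2 \<ge> 0" by simp_all
    ultimately have "real m1 < 1" by argo
    hence "m1 = 0" by simp
    thus ?thesis using m1 by (simp add: a_eq)
  qed
qed

subsection \<open>The prime number theorem\<close>

text \<open>The value at \<open>s = 0\<close> removes the singularity.\<close>

definition powr_slope :: "real \<Rightarrow> complex \<Rightarrow> complex" where
  "powr_slope n s = (if s = 0 then of_real (ln ((n + 1) / n)) else (of_real n powr (-s) - of_real (n + 1) powr (-s)) / s)"

lemma powr_slope_holomorphic:
  assumes "n > 0"
  shows "powr_slope n holomorphic_on UNIV"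
proof -
  define F where "F = (\<lambda>s. of_real n powr (-s) - of_real (n + 1) powr (-s) :: complex)"
  have nz: "of_real n \<noteq> (0::complex)" "of_real (n + 1) \<noteq> (0::complex)" using assms by (auto simp del: of_real_add)
  have "F holomorphic_on UNIV"
    unfolding F_def by (intro holomorphic_intros)
  hence "(\<lambda>z. if z = 0 then deriv F 0 else (F z - F 0) / (z - 0)) holomorphic_on UNIV"
    by (intro pole_lemma_open) auto
  moreover have "(F has_field_derivative (of_real (ln ((n + 1) / n)))) (at 0)"
  proof -
    have pw: "of_real m powr (-s) = exp (- s * of_real (ln m))" if "m > 0" for m and s :: complex
      using that by (simp add: powr_def Ln_of_real)
    have "((\<lambda>s. exp (- s * of_real (ln n)) - exp (- s * of_real (ln (n + 1)))) has_field_derivative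
            (of_real (ln ((n + 1) / n)))) (at 0)"
      using assms by (auto intro!: derivative_eq_intros simp: ln_div)
    thus ?thesis using assms by (simp add: F_def pw del: of_real_add)
  qed
  hence "deriv F 0 = of_real (ln ((n + 1) / n))" by (rule DERIV_imp_deriv)
  moreover have "F 0 = 0" using nz by (simp add: F_def)
  ultimately have "(\<lambda>z. if z = 0 then of_real (ln ((n + 1) / n)) else F z / z) holomorphic_on UNIV"
    by (simp cong: if_cong)
  thus ?thesis unfolding powr_slope_def F_def .
qed

text \<open>\<open>powr_slope n s\<close> is the integral of \<open>t powr (-s - 1)\<close> over
  \<open>[n, n + 1]\<close>. There \<open>n \<le> t\<close>, so the factor \<open>n\<close> raises
  the exponent by one, and the right-hand side is the integral of \<open>t powr (- Re s)\<close>. It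
  telescopes over \<open>n\<close>, as the Tauberian theorem demands.\<close>

lemma norm_powr_slope_le:
  assumes n: "n \<ge> 1" and x: "Re s \<noteq> 1"
  shows "n * norm (powr_slope n s) \<le> (n powr (1 - Re s) - (n + 1) powr (1 - Re s)) / (Re s - 1)"
proof (cases "s = 0")
  case True
  \<comment> \<open>For \<open>s = 0\<close> the right-hand side of the claim is 1.\<close>
  have "n * ln (1 + 1 / n) \<le> n * (1 / n)"
    using n by (intro mult_left_mono ln_add_one_self_le_self) auto
  moreover have "ln (1 + 1 / n) \<ge> 0" using n by simp
  moreover have "(n + 1) / n = 1 + 1 / n" using n by (simp add: field_simps)
  ultimately show ?thesis using True n by (simp add: powr_slope_def)
next
  case False
  define x where "x = Re s - 1"
  have x0: "x \<noteq> 0" using x by (simp add: x_def)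
  define \<phi> where "\<phi> = (\<lambda>t. - (norm s / n) * (t powr (-x) / x))"
  have "norm (of_real (n + 1) powr (-s) - of_real n powr (-s)) \<le> \<phi> (n + 1) - \<phi> n"
  proof (rule norm_of_real_powr_diff_le[where \<phi>' = "\<lambda>t. (norm s / n) * t powr (-x - 1)"])
    fix t assume t: "n \<le> t" "t \<le> n + 1"
    show "(\<phi> has_real_derivative (norm s / n) * t powr (-x - 1)) (at t)"
      unfolding \<phi>_def using t n x0 by (auto intro!: derivative_eq_intros)
  next
    fix t assume t: "n < t" "t < n + 1"
    have "t powr (Re (-s) - 1) = t powr (-x - 1) / t"
      using t n by (simp add: x_def powr_diff field_simps power2_eq_square powr_minus)
    also have "\<dots> \<le> t powr (-x - 1) / n"
      using t n by (intro divide_left_mono) auto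
    finally have "norm s * t powr (Re (-s) - 1) \<le> norm s * (t powr (-x - 1) / n)"
      by (intro mult_left_mono) auto
    thus "norm (-s) * t powr (Re (-s) - 1) \<le> (norm s / n) * t powr (-x - 1)" by simp
  qed (use n in auto)
  also have "\<phi> (n + 1) - \<phi> n = (norm s / n) * ((n powr (-x) - (n + 1) powr (-x)) / x)"
    by (simp add: \<phi>_def diff_divide_distrib right_diff_distrib)
  finally have "n * (norm (of_real (n + 1) powr (-s) - of_real n powr (-s)) / norm s) \<le> 
                 n * ((norm s / n) * ((n powr (-x) - (n + 1) powr (-x)) / x) / norm s)"
    using n by (intro mult_left_mono divide_right_mono) auto
  also have "\<dots> = (n powr (-x) - (n + 1) powr (-x)) / x" using n False by simp
  finally show ?thesis using False
    by (simp add: powr_slope_def x_def norm_divide norm_minus_commute)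
qed

lemma abel_summation_complex:
  fixes a u :: "nat \<Rightarrow> complex"
  shows "(\<Sum>k<N. (\<Sum>n=1..Suc k. a n) * (u (Suc k) - u (Suc (Suc k)))) =
           (\<Sum>n=1..N. a n * u n) - (\<Sum>n=1..N. a n) * u (Suc N)"
  by (induction N) (auto simp: algebra_simps)

text \<open>Abel summation writes \<open>(H s + c) / s\<close> as the series of
  \<open>A n * powr_slope n s\<close>, and the Tauberian theorem is applied to it with
  \<open>s = 1 + w\<close>. Its conclusion at \<open>w = 0\<close> is the claim, as
  \<open>powr_slope n 1 = 1 / (n * (n + 1))\<close>.\<close>

lemma chebyshev_psi_error_series:
  "\<exists>c. (\<lambda>k. (chebyshev_psi (Suc k) - real (Suc k) + c) / (real (Suc k) * real (Suc (Suc k)))) sums 0"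
proof -
  define z where "z = zeta_reg"
  define V where "V = {s. Re s > 0} \<inter> {s. Re s > 0 \<and> z s \<noteq> 0}"
  have holz: "z holomorphic_on {s. Re s > 0}" unfolding z_def by (rule zeta_reg_holomorphic)
  have openV: "open V"
  proof -
    have "open ({s. Re s > 0} \<inter> z -` (- {0}))"
      by (intro continuous_open_preimage holomorphic_on_imp_continuous_on[OF holz]) (auto simp: open_halfspace_Re_gt)
    moreover have "{s. Re s > 0} \<inter> z -` (- {0}) = V" by (auto simp: V_def)
    ultimately show ?thesis by simp
  qed
  have V1: "s \<in> V" if "Re s \<ge> 1" for s using that zeta_reg_nonzero[of s] by (auto simp: V_def z_def)
  have holzV: "z holomorphic_on V" by (rule holomorphic_on_subset[OF holz]) (auto simp: V_def)
  \<comment> \<open>Since \<open>z\<close> is \<open>s - 1\<close> times zeta, both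
    \<open>- deriv z s / z s\<close> and \<open>- (z s - z 1) / (s - 1)\<close> differ from the
    corresponding zeta expressions by \<open>1 / (s - 1)\<close>, with opposite signs. Hence
    \<open>H\<close> is minus the logarithmic derivative of zeta minus zeta, with the poles already
    cancelled.\<close>
  define H where "H = (\<lambda>s. - deriv z s / z s - (if s = 1 then deriv z 1 else (z s - z 1) / (s - 1)))"
  have holH: "H holomorphic_on V"
    unfolding H_def using openV holzV
    by (intro holomorphic_intros pole_lemma_open holomorphic_deriv) (auto simp: V_def)
  define c where "c = - H 1"
  define q where "q = (\<lambda>s. if s = 1 then deriv H 1 else (H s - H 1) / (s - 1))"
  have holq: "q holomorphic_on V" unfolding q_def by (rule pole_lemma_open[OF holH openV])
  \<comment> \<open>Chosen so that \<open>w * Q w = (H s + c) / s\<close> for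
    \<open>s = 1 + w\<close>.\<close>
  define Q where "Q = (\<lambda>w. q (1 + w) / (1 + w))"
  define U where "U = (\<lambda>w. 1 + w) -` V"
  define A where "A = (\<lambda>n. of_real (chebyshev_psi n - real n) + c)"
  \<comment> \<open>\<open>chebyshev_psi n\<close> contributes 4, the subtracted \<open>n\<close>
    contributes 1, and \<open>c\<close> is bounded by \<open>norm c * n\<close>.\<close>
  define C where "C = 5 + norm c"
  have C: "C \<ge> 0" by (simp add: C_def)
  have A_le: "norm (A n) \<le> C * real n" if "n \<ge> 1" for n
  proof -
    have "norm (A n) \<le> \<bar>chebyshev_psi n - real n\<bar> + norm c"
      unfolding A_def by (rule order.trans[OF norm_triangle_ineq]) (simp del: of_real_diff)
    also have "\<dots> \<le> (4 * real n + real n) + norm c * real n"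
      using chebyshev_psi_le[of n] chebyshev_psi_nonneg[of n] that mult_left_mono[of 1 "real n" "norm c"] by auto
    finally show ?thesis by (simp add: C_def algebra_simps)
  qed
  have H_eq: "mangoldt_series s - z s / (s - 1) = H s" if s: "Re s > 1" for s
  proof -
    have s1: "s \<noteq> 1" using s by auto
    have zs: "z s \<noteq> 0" using zeta_reg_nonzero[of s] s by (simp add: z_def)
    have "mangoldt_series s = 1 / (s - 1) - deriv z s / z s"
      using mangoldt_series_mult_zeta_reg[OF s] zs unfolding z_def[symmetric] by (simp add: field_simps)
    thus ?thesis using s1 by (simp add: H_def z_def zeta_reg_1 diff_divide_distrib)
  qed
  have "(\<lambda>k. A (Suc k) * powr_slope (real (Suc k)) (1 + 0)) sums 0"
  proof (rule newman_tauberian[where g = "\<lambda>k w. A (Suc k) * powr_slope (real (Suc k)) (1 + w)" and U = U and Q = Q, OF C])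
    show "(\<lambda>w. A (Suc k) * powr_slope (real (Suc k)) (1 + w)) holomorphic_on UNIV" for k
    proof -
      have "(powr_slope (real (Suc k)) \<circ> (\<lambda>w. 1 + w)) holomorphic_on UNIV"
        by (intro holomorphic_on_compose_gen[OF _ powr_slope_holomorphic] holomorphic_intros) auto
      thus ?thesis by (intro holomorphic_intros) (simp add: o_def)
    qed
    show "norm (A (Suc k) * powr_slope (real (Suc k)) (1 + w)) \<le>
            C * ((real (Suc k) powr (-Re w) - real (Suc (Suc k)) powr (-Re w)) / Re w)" if "Re w \<noteq> 0" for k w
    proof -
      have "norm (A (Suc k) * powr_slope (real (Suc k)) (1 + w)) \<le> 
              (C * real (Suc k)) * norm (powr_slope (real (Suc k)) (1 + w))"
        unfolding norm_mult by (intro mult_right_mono A_le) auto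
      also have "\<dots> = C * (real (Suc k) * norm (powr_slope (real (Suc k)) (1 + w)))" by simp
      also have "\<dots> \<le> C * ((real (Suc k) powr (1 - Re (1 + w)) - (real (Suc k) + 1) powr (1 - Re (1 + w))) / (Re (1 + w) - 1))"
        using that by (intro mult_left_mono[OF norm_powr_slope_le C]) auto
      finally show ?thesis by (simp add: add_ac)
    qed
    show "open U" unfolding U_def by (intro open_vimage openV continuous_intros)
    show "{w. Re w \<ge> 0} \<subseteq> U" using V1 by (auto simp: U_def)
    have "(q \<circ> (\<lambda>w. 1 + w)) holomorphic_on U"
      by (intro holomorphic_on_compose_gen[OF _ holq] holomorphic_intros) (auto simp: U_def)
    moreover have "1 + w \<noteq> 0" if "w \<in> U" for w
    proof
      assume "1 + w = 0"
      hence "Re (1 + w) = 0" by simp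
      thus False using that by (simp add: U_def V_def)
    qed
    ultimately show "Q holomorphic_on U"
      unfolding Q_def by (intro holomorphic_intros) (auto simp: o_def)
    show "(\<lambda>k. A (Suc k) * powr_slope (real (Suc k)) (1 + w)) sums (w * Q w)" if w: "Re w > 0" for w
    proof -
      define s where "s = 1 + w"
      have s: "Re s > 1" "s \<noteq> 0" "s \<noteq> 1" using w by (auto simp: s_def complex_eq_iff)
      define a where "a = (\<lambda>n::nat. mangoldt n - 1 + (if n = 1 then c else 0))"
      define u where "u = (\<lambda>n::nat. of_nat n powr (-s) :: complex)"
      have A_eq: "A n = (\<Sum>k=1..n. a k)" if "n \<ge> 1" for n
      proof -
        have "(\<Sum>k=1..n. if k = 1 then c else 0) = c" using that by simp
        moreover have "(\<Sum>k=1..n. mangoldt k :: complex) = of_real (chebyshev_psi n)" 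
          by (simp add: chebyshev_psi_def)
        ultimately show ?thesis by (simp add: a_def A_def sum.distrib sum_subtractf)
      qed
      have "(\<lambda>n. if n = 1 then c * u n else 0) sums (c * u 1)"
        using sums_single[of 1 "\<lambda>n. c * u n"] by simp
      hence "(\<lambda>n. mangoldt n * u n - u n + (if n = 1 then c * u n else 0)) sums
               (mangoldt_series s - z s / (s - 1) + c * u 1)"
        unfolding u_def z_def using s(1)
        by (intro sums_add sums_diff mangoldt_series_sums zeta_reg_conv_series)
      moreover have "mangoldt n * u n - u n + (if n = 1 then c * u n else 0) = a n * u n" for n
        by (simp add: a_def algebra_simps)
      ultimately have "(\<lambda>n. a n * u n) sums (H s + c)"
        using H_eq[OF s(1)] by (simp add: u_def)
      hence "(\<lambda>N. \<Sum>n\<le>N. a n * u n) \<longlonglongrightarrow> H s + c"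
        by (simp add: sums_def_le)
      moreover have "(\<Sum>n\<le>N. a n * u n) = (\<Sum>n=1..N. a n * u n)" for N
        by (rule sum.mono_neutral_right) (auto simp: u_def Suc_le_eq)
      ultimately have lim1: "(\<lambda>N. \<Sum>n=1..N. a n * u n) \<longlonglongrightarrow> H s + c" by simp
      have lim2: "(\<lambda>N. (\<Sum>n=1..N. a n) * u (Suc N)) \<longlonglongrightarrow> 0"
      proof (rule Lim_null_comparison)
        show "(\<lambda>N. C * (real N * real (Suc N) powr (- Re s))) \<longlonglongrightarrow> 0"
        proof (rule tendsto_mult_right_zero)
          have "(\<lambda>N. real N * real (Suc N) powr (- (1 + d))) \<longlonglongrightarrow> 0" if "d > 0" for d :: real
            using that by real_asymp
          from this[of "Re s - 1"] show "(\<lambda>N. real N * real (Suc N) powr (- Re s)) \<longlonglongrightarrow> 0" using s by simp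
        qed
        show "eventually (\<lambda>N. norm ((\<Sum>n=1..N. a n) * u (Suc N)) \<le> C * (real N * real (Suc N) powr (- Re s))) sequentially"
          using eventually_ge_at_top[of 1]
        proof eventually_elim
          case (elim N)
          have "norm ((\<Sum>n=1..N. a n) * u (Suc N)) \<le> (C * real N) * real (Suc N) powr (- Re s)"
            unfolding norm_mult u_def norm_of_nat_powr using A_le[OF elim] A_eq[OF elim] C by (intro mult_mono) auto
          thus ?case by (simp add: mult.assoc)
        qed
      qed
      have "(\<lambda>N. (\<Sum>k<N. (\<Sum>n=1..Suc k. a n) * (u (Suc k) - u (Suc (Suc k))))) \<longlonglongrightarrow> H s + c - 0"
        unfolding abel_summation_complex by (intro tendsto_diff lim1 lim2)
      hence "(\<lambda>k. A (Suc k) * (u (Suc k) - u (Suc (Suc k)))) sums (H s + c)"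
        unfolding sums_def by (simp add: A_eq del: sum.cl_ivl_Suc)
      hence "(\<lambda>k. A (Suc k) * (u (Suc k) - u (Suc (Suc k))) / s) sums ((H s + c) / s)"
        by (rule sums_divide)
      moreover have "A (Suc k) * (u (Suc k) - u (Suc (Suc k))) / s = A (Suc k) * powr_slope (real (Suc k)) s" for k
        using s by (simp add: powr_slope_def u_def add_ac)
      moreover have "(H s + c) / s = w * Q w"
      proof -
        have "w = s - 1" "w \<noteq> 0" using s by (auto simp: s_def)
        thus ?thesis using s by (simp add: Q_def q_def c_def)
      qed
      ultimately show ?thesis by (simp add: s_def)
    qed
  qed
  hence "(\<lambda>k. Re (A (Suc k) * powr_slope (real (Suc k)) 1)) sums Re 0"
    by (intro sums_Re) simp
  moreover have "Re (A (Suc k) * powr_slope (real (Suc k)) 1) = 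
      (chebyshev_psi (Suc k) - real (Suc k) + Re c) / (real (Suc k) * real (Suc (Suc k)))" for k
  proof -
    have "powr_slope (real (Suc k)) 1 = of_real (1 / real (Suc k) - 1 / (real (Suc k) + 1))"
      by (simp add: powr_slope_def powr_minus_divide del: of_nat_Suc flip: of_nat_Suc)
    also have "1 / real (Suc k) - 1 / (real (Suc k) + 1) = 1 / (real (Suc k) * real (Suc (Suc k)))"
      by (simp add: field_simps)
    finally show ?thesis by (simp add: A_def)
  qed
  ultimately show ?thesis by (intro exI[of _ "Re c"]) simp
qed

text \<open>If \<open>\<psi>(N)\<close> were at least \<open>(1 + \<epsilon>) N\<close>, monotonicity would make the terms of the convergent series
  bounded below by a multiple of \<open>\<epsilon> / N\<close> on a block of length \<open>\<epsilon> N / 2\<close> after \<open>N\<close>; symmetrically before \<open>N\<close>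
  if \<open>\<psi>(N) \<le> (1 - \<epsilon>) N\<close>.\<close>

lemma chebyshev_psi_asymptotic: "(\<lambda>n. chebyshev_psi n / real n) \<longlonglongrightarrow> 1"
proof -
  obtain c where c: "(\<lambda>k. (chebyshev_psi (Suc k) - real (Suc k) + c) / (real (Suc k) * real (Suc (Suc k)))) sums 0"
    using chebyshev_psi_error_series by blast
  define b where "b = (\<lambda>n. (chebyshev_psi n - real n + c) / (real n * (real n + 1)))"
  have "(\<lambda>k. b (Suc k)) sums 0" using c by (simp add: b_def add_ac)
  hence Cau: "Cauchy (\<lambda>N. \<Sum>k<N. b (Suc k))" by (simp add: sums_def LIMSEQ_imp_Cauchy)
  have block: "(\<Sum>k<N + K. b (Suc k)) - (\<Sum>k<N. b (Suc k)) = (\<Sum>n\<in>{N<..N+K}. b n)" for N K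
  proof -
    have "(\<Sum>k<N + K. b (Suc k)) - (\<Sum>k<N. b (Suc k)) = (\<Sum>k\<in>{N..<N+K}. b (Suc k))"
      using sum_diff_nat_ivl[of 0 N "N + K" "\<lambda>k. b (Suc k)"] by (simp add: atLeast0LessThan)
    also have "\<dots> = (\<Sum>n\<in>{N<..N+K}. b n)"
      by (rule sum.reindex_bij_witness[of _ "\<lambda>n. n - 1" Suc]) auto
    finally show ?thesis .
  qed
  have both: "eventually (\<lambda>N. \<bar>chebyshev_psi N - real N\<bar> < \<epsilon> * real N) sequentially"
    if \<epsilon>: "\<epsilon> > 0" "\<epsilon> < 1" for \<epsilon>
  proof -
    have "\<epsilon>\<^sup>2 / 64 > 0" using \<epsilon> by simp
    then obtain M where M: "\<And>m n. m \<ge> M \<Longrightarrow> n \<ge> M \<Longrightarrow> \<bar>(\<Sum>k<m. b (Suc k)) - (\<Sum>k<n. b (Suc k))\<bar> < \<epsilon>\<^sup>2 / 64"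
      using CauchyD[OF Cau, of "\<epsilon>\<^sup>2 / 64"] by auto
    \<comment> \<open>\<open>2 * M\<close> keeps the block before \<open>N\<close> beyond
      \<open>M\<close>, since its length is at most \<open>N / 2\<close>; the second bound makes
      \<open>c\<close> cost at most a quarter of \<open>\<epsilon> * N\<close>; the third lets the
      floor in \<open>K\<close> lose at most half.\<close>
    have "eventually (\<lambda>N. N \<ge> 2 * M \<and> real N \<ge> 4 * \<bar>c\<bar> / \<epsilon> \<and> real N \<ge> 4 / \<epsilon> \<and> N \<ge> 1) sequentially"
      by (intro eventually_conj eventually_ge_at_top 
            filterlim_at_top[THEN iffD1, OF filterlim_real_sequentially, rule_format])
    thus ?thesis
    proof eventually_elim
      case (elim N)
      have cN: "\<bar>c\<bar> \<le> \<epsilon> * real N / 4" and eN: "\<epsilon> * real N \<ge> 4" using elim \<epsilon> by (auto simp: field_simps)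
      have N0: "real N > 0" using elim by simp
      define K where "K = nat \<lfloor>\<epsilon> * real N / 2\<rfloor>"
      have K1: "real K \<le> \<epsilon> * real N / 2" unfolding K_def using \<epsilon> by (intro of_nat_floor) auto
      have K2: "real K \<ge> \<epsilon> * real N / 4"
        using eN unfolding K_def by linarith
      have KN: "real K \<le> real N / 2"
        using K1 \<epsilon> mult_right_mono[of \<epsilon> 1 "real N"] by simp
      have den: "real n * (real n + 1) \<le> 4 * (real N)\<^sup>2" "real n * (real n + 1) > 0" 
        if "n \<ge> 1" "real n \<le> real N + real K" for n
      proof -
        have "real n \<le> 2 * real N" "real n + 1 \<le> 2 * real N"
          using that KN K2 eN K1 \<epsilon> mult_right_mono[of \<epsilon> 1 "real N"] by linarith+
        hence "real n * (real n + 1) \<le> (2 * real N) * (2 * real N)" by (intro mult_mono) auto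
        thus "real n * (real n + 1) \<le> 4 * (real N)\<^sup>2" by (simp add: power2_eq_square)
        show "real n * (real n + 1) > 0" using that by simp
      qed
      \<comment> \<open>Of the error \<open>\<epsilon> * N\<close>, moving by at most
        \<open>K\<close> loses a half and \<open>c\<close> a quarter, which leaves the numerator;
        the denominators are at most \<open>(2 * N)\<^sup>2\<close>. At least
        \<open>\<epsilon> * N / 4\<close> such terms give the threshold
        \<open>\<epsilon>\<^sup>2 / 64\<close>.\<close>
      define \<delta> where "\<delta> = \<epsilon> * real N / 4 / (4 * (real N)\<^sup>2)"
      have big: "real K * \<delta> \<ge> \<epsilon>\<^sup>2 / 64"
      proof -
        have "\<epsilon>\<^sup>2 / 64 = (\<epsilon> * real N / 4) * \<delta>" using N0 by (simp add: \<delta>_def power2_eq_square)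
        also have "\<dots> \<le> real K * \<delta>" using K2 \<epsilon> by (intro mult_right_mono) (auto simp: \<delta>_def)
        finally show ?thesis .
      qed
      have frac: "\<delta> \<le> x / (real n * (real n + 1))" if "n \<ge> 1" "real n \<le> real N + real K" "x \<ge> \<epsilon> * real N / 4" for n x
      proof -
        have "0 \<le> \<epsilon> * real N / 4" using \<epsilon> by simp
        with that(3) have "x \<ge> 0" by linarith
        thus ?thesis unfolding \<delta>_def using that den[OF that(1,2)] by (intro frac_le) auto
      qed
      have upper: "chebyshev_psi N < (1 + \<epsilon>) * real N"
      proof (rule ccontr)
        assume "\<not> ?thesis"
        hence ge: "chebyshev_psi N \<ge> real N + \<epsilon> * real N" by (simp add: algebra_simps)
        have "real K * \<delta> = (\<Sum>n\<in>{N<..N+K}. \<delta>)" by simp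
        also have "\<dots> \<le> (\<Sum>n\<in>{N<..N+K}. b n)"
        proof (rule sum_mono)
          fix n assume n: "n \<in> {N<..N+K}"
          have "chebyshev_psi n \<ge> chebyshev_psi N" using n by (intro chebyshev_psi_mono) auto
          moreover have "real n \<le> real N + real K" using n by auto
          ultimately show "\<delta> \<le> b n" unfolding b_def using ge n K1 cN by (intro frac) auto
        qed
        also have "\<dots> < \<epsilon>\<^sup>2 / 64"
          using M[of "N + K" N] elim block[of N K] by auto
        finally show False using big by simp
      qed
      have lower: "chebyshev_psi N > (1 - \<epsilon>) * real N"
      proof (rule ccontr)
        assume "\<not> ?thesis"
        hence le: "chebyshev_psi N \<le> real N - \<epsilon> * real N" by (simp add: algebra_simps)
        define N' where "N' = N - K"
        have N': "N = N' + K" "N' \<ge> M" using KN elim by (auto simp: N'_def)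
        have "real K * \<delta> = (\<Sum>n\<in>{N'<..N'+K}. \<delta>)" by simp
        also have "\<dots> \<le> (\<Sum>n\<in>{N'<..N'+K}. - b n)"
        proof (rule sum_mono)
          fix n assume n: "n \<in> {N'<..N'+K}"
          have "chebyshev_psi n \<le> chebyshev_psi N" using n N' by (intro chebyshev_psi_mono) auto
          moreover have "real n \<ge> real N - real K" "real n \<le> real N" using n N' by auto
          ultimately have "\<delta> \<le> (- (chebyshev_psi n - real n + c)) / (real n * (real n + 1))" 
            using le n K1 cN by (intro frac) auto
          thus "\<delta> \<le> - b n" by (simp add: b_def minus_divide_left)
        qed
        also have "\<dots> < \<epsilon>\<^sup>2 / 64"
          using M[of "N' + K" N'] N' block[of N' K] by (auto simp: sum_negf)
        finally show False using big by simp
      qed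
      show ?case using upper lower by (simp add: algebra_simps abs_less_iff)
    qed
  qed
  show ?thesis
  proof (rule tendstoI)
    fix e :: real assume e: "e > 0"
    define \<epsilon> where "\<epsilon> = min e (1/2)"
    have "\<epsilon> > 0" "\<epsilon> < 1" "\<epsilon> \<le> e" using e by (auto simp: \<epsilon>_def)
    from both[OF this(1,2)] eventually_gt_at_top[of 0]
    show "eventually (\<lambda>n. dist (chebyshev_psi n / real n) 1 < e) sequentially"
    proof eventually_elim
      case (elim n)
      have "dist (chebyshev_psi n / real n) 1 = \<bar>chebyshev_psi n - real n\<bar> / real n"
      proof -
        have "chebyshev_psi n / real n - 1 = (chebyshev_psi n - real n) / real n"
          using elim by (simp add: field_simps)
        thus ?thesis by (simp add: dist_real_def)
      qed
      also have "\<dots> < \<epsilon>" using elim by (simp add: field_simps)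
      finally show ?case using \<open>\<epsilon> \<le> e\<close> by simp
    qed
  qed
qed

text \<open>The threshold \<open>n / ln n ^ 2\<close> is small enough to be negligible against
  \<open>n / ln n\<close> and large enough for its logarithm to be asymptotic to
  \<open>ln n\<close>.\<close>

lemma prime_pi_asymptotic_nat: "(\<lambda>n. real (prime_pi (real n)) * ln (real n) / real n) \<longlonglongrightarrow> 1"
proof (rule tendsto_sandwich)
  show "(\<lambda>n. chebyshev_psi n / real n) \<longlonglongrightarrow> 1" by (rule chebyshev_psi_asymptotic)
  show "eventually (\<lambda>n. chebyshev_psi n / real n \<le> real (prime_pi (real n)) * ln (real n) / real n) sequentially"
    by (intro always_eventually allI divide_right_mono chebyshev_psi_le_prime_pi) auto
  have "(\<lambda>n. ln (real n) / ln (real n / ln (real n) ^ 2)) \<longlonglongrightarrow> 1" by real_asymp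
  moreover have "(\<lambda>n. 1 / ln (real n)) \<longlonglongrightarrow> 0" by real_asymp
  ultimately have "(\<lambda>n. 1 / ln (real n) + (chebyshev_psi n / real n) * (ln (real n) / ln (real n / ln (real n) ^ 2))) \<longlonglongrightarrow> 0 + 1 * 1"
    by (intro tendsto_add tendsto_mult chebyshev_psi_asymptotic)
  thus "(\<lambda>n. 1 / ln (real n) + (chebyshev_psi n / real n) * (ln (real n) / ln (real n / ln (real n) ^ 2))) \<longlonglongrightarrow> 1" by simp
  have "eventually (\<lambda>n. real n / ln (real n) ^ 2 > 1) sequentially" by real_asymp
  thus "eventually (\<lambda>n. real (prime_pi (real n)) * ln (real n) / real n \<le> 
     1 / ln (real n) + (chebyshev_psi n / real n) * (ln (real n) / ln (real n / ln (real n) ^ 2))) sequentially"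
    using eventually_gt_at_top[of 1]
  proof eventually_elim
    case (elim n)
    define y where "y = real n / ln (real n) ^ 2"
    have ln: "ln (real n) > 0" using elim by simp
    have "real (prime_pi (real n)) * (ln (real n) / real n) \<le> (y + chebyshev_psi n / ln y) * (ln (real n) / real n)"
      using prime_pi_le_chebyshev_psi[of y n] elim ln by (intro mult_right_mono) (auto simp: y_def)
    also have "\<dots> = y * (ln (real n) / real n) + (chebyshev_psi n / real n) * (ln (real n) / ln y)"
      unfolding distrib_right by (simp add: mult_ac)
    also have "y * (ln (real n) / real n) = 1 / ln (real n)"
      using elim ln by (simp add: y_def power2_eq_square)
    finally show ?case by (simp add: y_def)
  qed
qed

theorem prime_number_theorem: "((\<lambda>x. real (prime_pi x) * ln x / x) \<longlongrightarrow> 1) at_top"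
proof -
  have flr: "filterlim (\<lambda>x::real. nat \<lfloor>x\<rfloor>) at_top at_top"
    by (rule filterlim_compose[OF filterlim_nat_sequentially filterlim_floor_sequentially])
  have "((\<lambda>x::real. ln x / x * (real_of_int \<lfloor>x\<rfloor> / ln (real_of_int \<lfloor>x\<rfloor>))) \<longlongrightarrow> 1) at_top" by real_asymp
  with filterlim_compose[OF prime_pi_asymptotic_nat flr]
  have "((\<lambda>x. (real (prime_pi (real (nat \<lfloor>x\<rfloor>))) * ln (real (nat \<lfloor>x\<rfloor>)) / real (nat \<lfloor>x\<rfloor>)) *
           (ln x / x * (real_of_int \<lfloor>x\<rfloor> / ln (real_of_int \<lfloor>x\<rfloor>)))) \<longlongrightarrow> 1 * 1) at_top"
    by (rule tendsto_mult)
  moreover have "eventually (\<lambda>x. (real (prime_pi (real (nat \<lfloor>x\<rfloor>))) * ln (real (nat \<lfloor>x\<rfloor>)) / real (nat \<lfloor>x\<rfloor>)) *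
           (ln x / x * (real_of_int \<lfloor>x\<rfloor> / ln (real_of_int \<lfloor>x\<rfloor>))) = real (prime_pi x) * ln x / x) at_top"
    using eventually_ge_at_top[of 2]
  proof eventually_elim
    case (elim x)
    define m where "m = real_of_int \<lfloor>x\<rfloor>"
    have m: "m \<ge> 2" using elim by (simp add: m_def le_floor_iff)
    have m_eq: "real (nat \<lfloor>x\<rfloor>) = m" using elim by (simp add: m_def)
    have "real p \<le> x \<longleftrightarrow> real p \<le> m" for p
      unfolding m_def by (metis le_floor_iff of_int_le_iff of_int_of_nat_eq)
    hence "prime_pi m = prime_pi x" by (simp add: prime_pi_def)
    moreover have "ln m \<noteq> 0" "m \<noteq> 0" using m by auto
    ultimately show ?case unfolding m_eq m_def[symmetric] by simp
  qed
  ultimately show ?thesis by (subst (asm) tendsto_cong) auto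
qed

text \<open>The domination in Tannery's theorem needs a bound for every \<open>x > 1\<close>, not
  only an asymptotic one. Below the point \<open>X\<close> where the limit takes effect,
  \<open>prime_pi x \<le> x\<close> and \<open>ln x \<le> ln (max X 2)\<close> suffice.\<close>

lemma prime_pi_upper_bound: "\<exists>B\<ge>0. \<forall>x>1. real (prime_pi x) \<le> B * x / ln x"
proof -
  have "eventually (\<lambda>x. real (prime_pi x) * ln x / x < 2) at_top"
    using prime_number_theorem by (rule order_tendstoD) simp
  then obtain X where X: "\<And>x. x \<ge> X \<Longrightarrow> real (prime_pi x) * ln x / x < 2"
    by (auto simp: eventually_at_top_linorder)
  define B where "B = max 2 (ln (max X 2))"
  have "real (prime_pi x) \<le> B * x / ln x" if x: "x > 1" for x
  proof -
    have lnx: "ln x > 0" using x by simp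
    have "real (prime_pi x) * ln x \<le> B * x"
    proof (cases "x \<ge> X")
      case True
      hence "real (prime_pi x) * ln x \<le> 2 * x" using X[of x] x by (simp add: field_simps)
      also have "\<dots> \<le> B * x" using x by (intro mult_right_mono) (auto simp: B_def)
      finally show ?thesis .
    next
      case False
      have "real (prime_pi x) * ln x \<le> x * ln (max X 2)"
        using False x lnx prime_pi_le_self[of x] by (intro mult_mono) auto
      also have "\<dots> \<le> x * B" using x by (intro mult_left_mono) (auto simp: B_def)
      finally show ?thesis by (simp add: mult.commute)
    qed
    thus ?thesis using lnx by (simp add: field_simps)
  qed
  moreover have "B \<ge> 0" by (simp add: B_def)
  ultimately show ?thesis by blast
qed

subsection \<open>Counting SP numbers\<close>

lemma prime_mult_square_eq_iff:
  fixes p q a b :: nat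
  assumes "prime p" "prime q" "a > 0" "b > 0"
  shows "p * a\<^sup>2 = q * b\<^sup>2 \<longleftrightarrow> p = q \<and> a = b"
proof
  assume eq: "p * a\<^sup>2 = q * b\<^sup>2"
  have "p = q"
  proof (rule ccontr)
    assume "p \<noteq> q"
    hence "multiplicity p q = 0"
      using assms by (metis not_dvd_imp_multiplicity_0 primes_dvd_imp_eq)
    hence "multiplicity p (q * b\<^sup>2) = 2 * multiplicity p b"
      using assms by (simp add: prime_elem_multiplicity_mult_distrib prime_elem_multiplicity_power_distrib prime_gt_0_nat)
    moreover have "multiplicity p (p * a\<^sup>2) = 1 + 2 * multiplicity p a"
      using assms by (simp add: prime_elem_multiplicity_mult_distrib prime_elem_multiplicity_power_distrib prime_gt_0_nat)
    ultimately have "2 * multiplicity p b = 1 + 2 * multiplicity p a" using eq by metis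
    thus False by presburger
  qed
  thus "p = q \<and> a = b" using eq assms by simp
qed auto

text \<open>The index is \<open>k = a - 2\<close>. The range \<open>k < n\<close> covers all cases
  because \<open>a \<le> a\<^sup>2 \<le> m < n\<close>, and the strict inequality
  \<open>m < n\<close> turns into \<open>n - 1\<close> in the argument of
  \<open>prime_pi\<close>.\<close>

lemma SP_count_eq_sum: "SP_count n = (\<Sum>k<n. prime_pi ((real n - 1) / (real k + 2)\<^sup>2))"
proof -
  define S where "S = (SIGMA k:{..<n}. {p. prime p \<and> p * (k + 2)\<^sup>2 < n})"
  have fin: "finite {p :: nat. prime p \<and> p * (k + 2)\<^sup>2 < n}" for k
    by (rule finite_subset[of _ "{..<n}"]) (auto intro: le_less_trans[rotated])
  have "{m. m < n \<and> SP_number m} = (\<lambda>(k, p). p * (k + 2)\<^sup>2) ` S"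
  proof (intro equalityI subsetI)
    fix m assume "m \<in> {m. m < n \<and> SP_number m}"
    then obtain p a where pa: "prime p" "a \<ge> 2" "m = p * a\<^sup>2" "m < n" by (auto simp: SP_number_def)
    define k where "k = a - 2"
    have a: "a = k + 2" using pa by (simp add: k_def)
    have "k < a" "a \<le> a\<^sup>2" using a by (simp_all add: power2_eq_square)
    moreover have "a\<^sup>2 \<le> m" using pa prime_gt_0_nat[of p] by simp
    ultimately have "k < n" using pa by linarith
    thus "m \<in> (\<lambda>(k, p). p * (k + 2)\<^sup>2) ` S" using pa a by (force simp: S_def)
  next
    fix m assume "m \<in> (\<lambda>(k, p). p * (k + 2)\<^sup>2) ` S"
    then obtain k p where kp: "prime p" "m = p * (k + 2)\<^sup>2" "m < n" by (auto simp: S_def)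
    hence "SP_number m" unfolding SP_number_def by (intro exI[of _ p] exI[of _ "k + 2"]) auto
    thus "m \<in> {m. m < n \<and> SP_number m}" using kp by simp
  qed
  moreover have "inj_on (\<lambda>(k, p). p * (k + 2)\<^sup>2) S"
    by (rule inj_onI) (auto simp: S_def prime_mult_square_eq_iff simp del: add_2_eq_Suc')
  ultimately have "SP_count n = card S"
    by (simp add: SP_count_def card_image)
  also have "\<dots> = (\<Sum>k<n. card {p. prime p \<and> p * (k + 2)\<^sup>2 < n})"
    unfolding S_def using fin by (intro card_SigmaI) auto
  also have "\<dots> = (\<Sum>k<n. prime_pi ((real n - 1) / (real k + 2)\<^sup>2))"
  proof (rule sum.cong[OF refl])
    fix k assume "k \<in> {..<n}"
    have "p * (k + 2)\<^sup>2 < n \<longleftrightarrow> real p \<le> (real n - 1) / (real k + 2)\<^sup>2" for p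
    proof -
      have "p * (k + 2)\<^sup>2 < n \<longleftrightarrow> p * (k + 2)\<^sup>2 + 1 \<le> n" by linarith
      also have "\<dots> \<longleftrightarrow> real (p * (k + 2)\<^sup>2 + 1) \<le> real n" by (rule of_nat_le_iff[symmetric])
      also have "\<dots> \<longleftrightarrow> real p * (real k + 2)\<^sup>2 \<le> real n - 1" by (auto simp: add_ac)
      also have "\<dots> \<longleftrightarrow> real p \<le> (real n - 1) / (real k + 2)\<^sup>2"
        by (subst pos_le_divide_eq) auto
      finally show ?thesis .
    qed
    thus "card {p. prime p \<and> p * (k + 2)\<^sup>2 < n} = prime_pi ((real n - 1) / (real k + 2)\<^sup>2)"
      by (simp add: prime_pi_def)
  qed
  finally show ?thesis .
qed

lemma prime_pi_eq_0: "x < 2 \<Longrightarrow> prime_pi x = 0"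
proof -
  assume "x < 2"
  have "\<not> real p \<le> x" if "prime p" for p :: nat
    using prime_ge_2_nat[OF that] \<open>x < 2\<close> by linarith
  hence eq: "{p :: nat. prime p \<and> real p \<le> x} = {}" by blast
  show ?thesis unfolding prime_pi_def eq by simp
qed

text \<open>Tannery's theorem wants a series whose range does not depend on \<open>n\<close>; the
  added terms vanish because their arguments are below 2.\<close>

lemma SP_count_sums:
  "(\<lambda>k. real (prime_pi ((real n - 1) / (real k + 2)\<^sup>2))) sums real (SP_count n)"
proof -
  have "prime_pi ((real n - 1) / (real k + 2)\<^sup>2) = 0" if "k \<notin> {..<n}" for k
  proof (rule prime_pi_eq_0)
    have "real n - 1 < real k + 2" using that by simp
    also have "\<dots> \<le> 2 * (real k + 2)\<^sup>2" by (simp add: power2_eq_square algebra_simps)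
    finally show "(real n - 1) / (real k + 2)\<^sup>2 < 2" by (subst pos_divide_less_eq) auto
  qed
  hence "(\<lambda>k. real (prime_pi ((real n - 1) / (real k + 2)\<^sup>2))) sums
           (\<Sum>k<n. real (prime_pi ((real n - 1) / (real k + 2)\<^sup>2)))"
    by (intro sums_finite) auto
  thus ?thesis by (simp add: SP_count_eq_sum)
qed

text \<open>The logarithms of \<open>n\<close> and of \<open>(n - 1) / a\<^sup>2\<close> are
  asymptotic for fixed \<open>a\<close>, so only the ratio of the arguments remains.\<close>

lemma SP_summand_limit:
  assumes a: "a > 0"
  shows "(\<lambda>n. real (prime_pi ((real n - 1) / a\<^sup>2)) * ln (real n) / real n) \<longlonglongrightarrow> 1 / a\<^sup>2"
proof -
  define c where "c = 1 / a\<^sup>2"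
  have c: "c > 0" using a by (simp add: c_def)
  have "filterlim (\<lambda>n. (real n - 1) * c) at_top sequentially" using c by real_asymp
  from filterlim_compose[OF prime_number_theorem this]
  have "(\<lambda>n. real (prime_pi ((real n - 1) * c)) * ln ((real n - 1) * c) / ((real n - 1) * c)) \<longlonglongrightarrow> 1" .
  moreover have "(\<lambda>n. ((real n - 1) * c) / ln ((real n - 1) * c) * (ln (real n) / real n)) \<longlonglongrightarrow> c"
    using c by real_asymp
  ultimately have "(\<lambda>n. (real (prime_pi ((real n - 1) * c)) * ln ((real n - 1) * c) / ((real n - 1) * c)) *
      (((real n - 1) * c) / ln ((real n - 1) * c) * (ln (real n) / real n))) \<longlonglongrightarrow> 1 * c"
    by (rule tendsto_mult)
  moreover have "eventually (\<lambda>n. (real n - 1) * c > 1) sequentially" using c by real_asymp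
  hence "eventually (\<lambda>n. (real (prime_pi ((real n - 1) * c)) * ln ((real n - 1) * c) / ((real n - 1) * c)) *
      (((real n - 1) * c) / ln ((real n - 1) * c) * (ln (real n) / real n)) =
      real (prime_pi ((real n - 1) * c)) * ln (real n) / real n) sequentially"
  proof eventually_elim
    case (elim n)
    define y where "y = (real n - 1) * c"
    have "ln y \<noteq> 0" "y \<noteq> 0" using elim by (auto simp: y_def[symmetric])
    thus ?case unfolding y_def[symmetric] by simp
  qed
  ultimately have "(\<lambda>n. real (prime_pi ((real n - 1) * c)) * ln (real n) / real n) \<longlonglongrightarrow> c"
    by (subst (asm) tendsto_cong) auto
  thus ?thesis by (simp add: c_def)
qed

text \<open>For \<open>a\<^sup>4 < n\<close> the Chebyshev bound applies with \<open>ln (n / a\<^sup>2) \<ge> ln n / 2\<close>; for larger \<open>a\<close>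
  the trivial bound suffices since then \<open>ln n \<le> 4 ln a\<close>.\<close>

lemma SP_summand_bound:
  "\<exists>B. \<forall>n. \<forall>a\<ge>2. \<bar>real (prime_pi ((real n - 1) / a\<^sup>2)) * ln (real n) / real n\<bar> \<le> B * a powr (-3/2)"
proof -
  obtain B where B: "B \<ge> 0" "\<And>x. x > 1 \<Longrightarrow> real (prime_pi x) \<le> B * x / ln x"
    using prime_pi_upper_bound by blast
  \<comment> \<open>\<open>2 * B\<close> serves the case \<open>a ^ 4 < n\<close> and 8 the other;
    their sum covers both.\<close>
  have "\<bar>real (prime_pi ((real n - 1) / a\<^sup>2)) * ln (real n) / real n\<bar> \<le> (2 * B + 8) * a powr (-3/2)"
    if a: "a \<ge> 2" for n a
  proof (cases "n \<le> 1")
    case True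
    hence "n = 0 \<or> n = 1" by auto
    thus ?thesis using B by auto
  next
    case False
    hence n: "real n > 1" and lnn: "ln (real n) > 0" by auto
    define v where "v = real n / a\<^sup>2"
    have v: "v > 0" using n a by (simp add: v_def)
    have "real (prime_pi ((real n - 1) / a\<^sup>2)) \<le> real (prime_pi v)"
      unfolding v_def of_nat_le_iff by (intro prime_pi_mono divide_right_mono) auto
    hence "\<bar>real (prime_pi ((real n - 1) / a\<^sup>2)) * ln (real n) / real n\<bar> \<le> real (prime_pi v) * ln (real n) / real n"
      using n lnn by (auto intro!: divide_right_mono mult_right_mono)
    also have "\<dots> \<le> (2 * B + 8) * a powr (-3/2)"
    proof (cases "a ^ 4 < real n")
      case True
      \<comment> \<open>\<open>a ^ 4 < n\<close> is equivalent to \<open>n < v * v\<close>, which is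
        the comparison of logarithms.\<close>
      have "v * v * (a\<^sup>2 * a\<^sup>2) = real n * real n" using a by (simp add: v_def)
      moreover have "a\<^sup>2 * a\<^sup>2 = a ^ 4" by (simp add: power_numeral_reduce)
      ultimately have "v * v * a ^ 4 = real n * real n" by simp
      moreover have "real n * a ^ 4 < real n * real n" using True n by (intro mult_strict_left_mono) auto
      ultimately have "real n * a ^ 4 < (v * v) * a ^ 4" by simp
      hence vv: "real n < v * v" using a by (subst (asm) mult_less_cancel_right_pos) auto
      hence "ln (real n) < ln (v * v)" using n v by (subst ln_less_cancel_iff) auto
      hence lnv: "ln v > ln (real n) / 2" using v by (simp add: ln_mult)
      have v1: "v > 1"
        using lnv lnn v by (metis half_gt_zero less_trans ln_gt_zero_iff)
      have "real (prime_pi v) \<le> B * v / ln v" by (rule B(2)[OF v1])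
      also have "\<dots> \<le> B * v / (ln (real n) / 2)"
        using lnv lnn B v v1 by (intro divide_left_mono) auto
      finally have "real (prime_pi v) * ln (real n) / real n \<le> B * v / (ln (real n) / 2) * ln (real n) / real n"
        using n lnn by (intro divide_right_mono mult_right_mono) auto
      also have "\<dots> = 2 * B / a\<^sup>2" using n lnn by (simp add: v_def)
      also have "\<dots> = 2 * B * a powr (-2)" using a by (simp add: powr_minus_divide)
      also have "\<dots> \<le> (2 * B + 8) * a powr (-3/2)"
        using B a by (intro mult_mono powr_mono) auto
      finally show ?thesis .
    next
      case False
      have "ln (real n) \<le> ln (a ^ 4)" using False n a by (subst ln_le_cancel_iff) auto
      also have "\<dots> = 4 * ln a" using a by (simp add: ln_realpow)
      \<comment> \<open>The logarithm is traded for the power 1/2, so that the total exponent -3/2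
        is still below -1.\<close>
      also have "\<dots> \<le> 4 * (a powr (1/2) / (1/2))" using a by (intro mult_left_mono ln_powr_bound) auto
      finally have l: "ln (real n) \<le> 8 * a powr (1/2)" by simp
      have "real (prime_pi v) * ln (real n) / real n \<le> v * (8 * a powr (1/2)) / real n"
        using l v lnn n prime_pi_le_self[of v] by (intro divide_right_mono mult_mono) auto
      also have "\<dots> = 8 * (a powr (1/2) * a powr (-2))" using n a by (simp add: v_def powr_minus_divide)
      also have "\<dots> = 8 * a powr (-3/2)" by (subst powr_add[symmetric]) simp
      also have "\<dots> \<le> (2 * B + 8) * a powr (-3/2)" using B by (intro mult_right_mono) auto
      finally show ?thesis .
    qed
    finally show ?thesis .
  qed
  thus ?thesis by blast
qed

lemma zeta_real_2_minus_1: "(\<lambda>k. 1 / (real k + 2)\<^sup>2) sums (zeta_real 2 - 1)"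
proof -
  have "summable (\<lambda>k. 1 / real (Suc k) powr 2)"
    using summable_Suc_powr[of "-2"] by (simp add: powr_minus_divide)
  hence "(\<lambda>k. 1 / real (Suc k) powr 2) sums zeta_real 2"
    unfolding zeta_real_def by (rule summable_sums)
  hence "(\<lambda>k. 1 / real (Suc (Suc k)) powr 2) sums (zeta_real 2 - 1 / real (Suc 0) powr 2)"
    by (subst sums_Suc_iff) simp
  thus ?thesis by (simp add: add_ac)
qed

theorem theorem1:
  shows "(\<lambda>n. real (SP_count n) / ((zeta_real 2 - 1) * real n / ln (real n)))
           \<longlonglongrightarrow> 1"
proof -
  define f where "f = (\<lambda>k n. real (prime_pi ((real n - 1) / (real k + 2)\<^sup>2)) * (ln (real n) / real n))"
  obtain B where B: "\<And>n a. a \<ge> 2 \<Longrightarrow> \<bar>real (prime_pi ((real n - 1) / a\<^sup>2)) * ln (real n) / real n\<bar> \<le> B * a powr (-3/2)"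
    using SP_summand_bound by blast
  have "(\<lambda>n. \<Sum>k. f k n) \<longlonglongrightarrow> (\<Sum>k. 1 / (real k + 2)\<^sup>2)"
  proof (rule tannerys_theorem[THEN conjunct2, THEN conjunct2])
    show "(f k \<longlongrightarrow> 1 / (real k + 2)\<^sup>2) sequentially" for k
      using SP_summand_limit[of "real k + 2"] by (simp add: f_def)
    show "eventually (\<lambda>(k, n). norm (f k n) \<le> B * (real k + 2) powr (-3/2)) (sequentially \<times>\<^sub>F sequentially)"
      using B[of "real k + 2" for k] by (intro always_eventually) (simp add: f_def)
    have "summable (\<lambda>k. real (Suc (Suc k)) powr (-3/2))"
      using summable_Suc_powr[of "-3/2"] by (subst summable_Suc_iff) auto
    thus "summable (\<lambda>k. B * (real k + 2) powr (-3/2))"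
      by (intro summable_mult) (simp add: add_ac)
  qed auto
  moreover have "(\<Sum>k. 1 / (real k + 2)\<^sup>2) = zeta_real 2 - 1"
    using zeta_real_2_minus_1 by (rule sums_unique[symmetric])
  moreover have "(\<Sum>k. f k n) = real (SP_count n) * (ln (real n) / real n)" for n
    unfolding f_def by (rule sums_unique[symmetric, OF sums_mult2[OF SP_count_sums]])
  ultimately have "(\<lambda>n. real (SP_count n) * (ln (real n) / real n)) \<longlonglongrightarrow> zeta_real 2 - 1" by simp
  moreover have pos: "zeta_real 2 - 1 > 0"
    using zeta_real_2_minus_1 suminf_pos[of "\<lambda>k. 1 / (real k + 2)\<^sup>2"] by (simp add: sums_iff)
  ultimately have "(\<lambda>n. real (SP_count n) * (ln (real n) / real n) / (zeta_real 2 - 1)) \<longlonglongrightarrow> (zeta_real 2 - 1) / (zeta_real 2 - 1)"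
    by (intro tendsto_divide tendsto_const) auto
  thus ?thesis using pos by (simp add: field_simps)
qed

end
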